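(* Let $s\in\overline{\mathbf R_\flat}$, let $f_j\in\mathcal H_s'(\mathbf R^{d_j})$ for $j=1,2$, let $\varphi\in\mathcal H_s(\mathbf R^{d_1+d_2})$, and let $$\psi_1(x_1)=\langle f_2,\varphi(x_1,\cdot)\rangle\ (x_1\in\mathbf R^{d_1}),\qquad \psi_2(x_2)=\langle f_1,\varphi(\cdot,x_2)\rangle\ (x_2\in\mathbf R^{d_2}).$$ Then $\psi_j\in\mathcal H_s(\mathbf R^{d_j})$, $j=1,2$, and there is a unique $f\in\mathcal H_s'(\mathbf R^{d_1+d_2})$ such that for every $\varphi_1\in\mathcal H_s(\mathbf R^{d_1})$ and $\varphi_2\in\mathcal H_s(\mathbf R^{d_2})$, $$\langle f,\varphi_1\otimes\varphi_2\rangle=\langle f_1,\varphi_1\rangle\,\langle f_2,\varphi_2\rangle\qquad\text{and}\qquad \langle f,\varphi\rangle=\langle f_1,\psi_1\rangle=\langle f_2,\psi_2\rangle$$ hold. The same holds true, for $s\in\mathbf R_\flat$, with $\mathcal H_{0,s}$ and $\mathcal H_{0,s}'$ in place of $\mathcal H_s$ and $\mathcal H_s'$, respectively, at each occurrence.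
   Context: Orders: $\mathbf R_\flat=\mathbf R_+\cup\{\flat_\sigma:\sigma\in\mathbf R_+\}$, where $\mathbf R_+=(0,\infty)$ and the $\flat_\sigma$ are formal symbols, and $\overline{\mathbf R_\flat}=\mathbf R_\flat\cup\{0\}$. Hermite functions: for $\alpha\in\mathbf N^d$, $h_\alpha(x)=\pi^{-d/4}(-1)^{|\alpha|}(2^{|\alpha|}\alpha!)^{-1/2}e^{|x|^2/2}(\partial^\alpha e^{-|x|^2})$; they form an orthonormal basis of $L^2(\mathbf R^d)$. A formal Hermite series expansion is a formal sum $f=\sum_{\alpha\in\mathbf N^d}c_h(f,\alpha)h_\alpha$ with arbitrary coefficients $c_h(f,\alpha)\in\mathbf C$; for $f\in L^2(\mathbf R^d)$, $c_h(f,\alpha)=(f,h_\alpha)_{L^2(\mathbf R^d)}$. For $r>0$ set $\vartheta_{r,s}(\alpha)=e^{-r|\alpha|^{1/(2s)}}$ and $\vartheta_{r,s}'(\alpha)=e^{r|\alpha|^{1/(2s)}}$ if $s\in\mathbf R_+$, and $\vartheta_{r,s}(\alpha)=r^{|\alpha|}\alpha!^{-1/(2\sigma)}$ and $\vartheta_{r,s}'(\alpha)=r^{|\alpha|}\alpha!^{1/(2\sigma)}$ if $s=\flat_\sigma$. Pilipović spaces: $\mathcal H_0(\mathbf R^d)$ is the set of all finite linear combinations of Hermite functions, and $\mathcal H_0'(\mathbf R^d)$ is the set of all formal Hermite series expansions. For $s\in\mathbf R_\flat$, $\mathcal H_s(\mathbf R^d)$ (respectively $\mathcal H_{0,s}(\mathbf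 R^d)$) is the set of all $f\in L^2(\mathbf R^d)$ such that $|c_h(f,\alpha)|\lesssim\vartheta_{r,s}(\alpha)$ for some $r>0$ (respectively for every $r>0$); $\mathcal H_s'(\mathbf R^d)$ (respectively $\mathcal H_{0,s}'(\mathbf R^d)$) is the set of all formal Hermite series expansions such that $|c_h(f,\alpha)|\lesssim\vartheta'_{r,s}(\alpha)$ for every $r>0$ (respectively for some $r>0$). Here $\lesssim$ means inequality up to a constant independent of $\alpha$. Elements of $\mathcal H_s(\mathbf R^d)$ and $\mathcal H_{0,s}(\mathbf R^d)$ are identified with their smooth representatives, given pointwise by their Hermite series. The duality pairing is bilinear: $\langle f,\varphi\rangle=\sum_{\alpha}c_h(f,\alpha)c_h(\varphi,\alpha)$. Tensor product of functions: $(\varphi_1\otimes\varphi_2)(x_1,x_2)=\varphi_1(x_1)\varphi_2(x_2)$. $d_1,d_2$ are positive integers. *)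

theory Defs
  imports "HOL-Analysis.Analysis"
begin

text \<open>
  Euclidean space of dimension $d$ is \<^typ>\<open>real ^ 'd\<close> for a finite index type (so $d \ge 1$), and
  multi-indices are functions \<^typ>\<open>'d \<Rightarrow> nat\<close>. The space of dimension $d_1 + d_2$ is
  \<^typ>\<open>real ^ ('m + 'n)\<close>, the first block of coordinates being indexed by \<open>Inl\<close>, the second by \<open>Inr\<close>.
\<close>

datatype pil_order = Ord real | Flat real

definition R_flat :: "pil_order set" where
  "R_flat = {Ord s | s. s > 0} \<union> {Flat \<sigma> | \<sigma>. \<sigma> > 0}"

definition R_flat_bar :: "pil_order set" where
  "R_flat_bar = insert (Ord 0) R_flat"

definition mlength :: "('d::finite \<Rightarrow> nat) \<Rightarrow> nat" where
  "mlength \<alpha> = (\<Sum>i\<in>UNIV. \<alpha> i)"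

definition mfact :: "('d::finite \<Rightarrow> nat) \<Rightarrow> nat" where
  "mfact \<alpha> = (\<Prod>i\<in>UNIV. fact (\<alpha> i))"

definition partial_deriv :: "'d::finite \<Rightarrow> (real ^ 'd \<Rightarrow> real) \<Rightarrow> real ^ 'd \<Rightarrow> real" where
  "partial_deriv i g x = deriv (\<lambda>t. g (x + t *\<^sub>R axis i 1)) 0"

text \<open>
  The index type carries no order, so the partial derivatives are composed along some enumeration
  of the coordinates. For smooth functions the choice is immaterial.
\<close>

definition coords :: "'d::finite list" where
  "coords = (SOME xs. distinct xs \<and> set xs = UNIV)"

definition multi_deriv :: "('d::finite \<Rightarrow> nat) \<Rightarrow> (real ^ 'd \<Rightarrow> real) \<Rightarrow> real ^ 'd \<Rightarrow> real" where
  "multi_deriv \<alpha> g = foldr (\<lambda>i. partial_deriv i ^^ \<alpha> i) coords g"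

definition hermite_fun :: "('d::finite \<Rightarrow> nat) \<Rightarrow> real ^ 'd \<Rightarrow> real" where
  "hermite_fun \<alpha> x =
     pi powr (- real CARD('d) / 4) * (-1) ^ mlength \<alpha>
     * (2 ^ mlength \<alpha> * real (mfact \<alpha>)) powr (- 1 / 2)
     * exp ((norm x)\<^sup>2 / 2) * multi_deriv \<alpha> (\<lambda>y. exp (- (norm y)\<^sup>2)) x"

definition L2_fun :: "(real ^ 'd::finite \<Rightarrow> complex) \<Rightarrow> bool" where
  "L2_fun f \<longleftrightarrow> f \<in> borel_measurable lborel \<and> integrable lborel (\<lambda>x. (cmod (f x))\<^sup>2)"

definition L2_inner :: "(real ^ 'd::finite \<Rightarrow> complex) \<Rightarrow> (real ^ 'd \<Rightarrow> complex) \<Rightarrow> complex" where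
  "L2_inner f g = (LINT x|lborel. f x * cnj (g x))"

definition hermite_coeff :: "(real ^ 'd::finite \<Rightarrow> complex) \<Rightarrow> ('d \<Rightarrow> nat) \<Rightarrow> complex" where
  "hermite_coeff f \<alpha> = L2_inner f (\<lambda>x. complex_of_real (hermite_fun \<alpha> x))"

fun weight :: "real \<Rightarrow> pil_order \<Rightarrow> ('d::finite \<Rightarrow> nat) \<Rightarrow> real" where
  "weight r (Ord s) \<alpha> = exp (- r * real (mlength \<alpha>) powr (1 / (2 * s)))"
| "weight r (Flat \<sigma>) \<alpha> = r ^ mlength \<alpha> * real (mfact \<alpha>) powr (- 1 / (2 * \<sigma>))"

fun weight' :: "real \<Rightarrow> pil_order \<Rightarrow> ('d::finite \<Rightarrow> nat) \<Rightarrow> real" where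
  "weight' r (Ord s) \<alpha> = exp (r * real (mlength \<alpha>) powr (1 / (2 * s)))"
| "weight' r (Flat \<sigma>) \<alpha> = r ^ mlength \<alpha> * real (mfact \<alpha>) powr (1 / (2 * \<sigma>))"

definition dominated :: "(('d::finite \<Rightarrow> nat) \<Rightarrow> complex) \<Rightarrow> (('d \<Rightarrow> nat) \<Rightarrow> real) \<Rightarrow> bool" where
  "dominated c w \<longleftrightarrow> (\<exists>C. \<forall>\<alpha>. cmod (c \<alpha>) \<le> C * w \<alpha>)"

text \<open>
  The spaces of functions consist of genuine functions rather than classes modulo null sets: the
  representative is the one given at every point by its Hermite series.
\<close>

definition hermite_series_rep :: "(real ^ 'd::finite \<Rightarrow> complex) \<Rightarrow> bool" where
  "hermite_series_rep f \<longleftrightarrow>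
     (\<forall>x. ((\<lambda>\<alpha>. hermite_coeff f \<alpha> * complex_of_real (hermite_fun \<alpha> x)) has_sum f x) UNIV)"

definition pil0 :: "(real ^ 'd::finite \<Rightarrow> complex) set" where
  "pil0 = {f. \<exists>A c. finite A \<and> f = (\<lambda>x. \<Sum>\<alpha>\<in>A. c \<alpha> * complex_of_real (hermite_fun \<alpha> x))}"

text \<open>
  \<open>pil s\<close> and \<open>pil_dual s\<close> are $\mathcal H_s$ and $\mathcal H_s'$ (including $s = 0$);
  \<open>pil_small s\<close> and \<open>pil_small_dual s\<close> are $\mathcal H_{0,s}$ and $\mathcal H_{0,s}'$.
  A formal Hermite series is its family of coefficients.
\<close>

definition pil :: "pil_order \<Rightarrow> (real ^ 'd::finite \<Rightarrow> complex) set" where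
  "pil s = (if s = Ord 0 then pil0
     else {f. L2_fun f \<and> hermite_series_rep f \<and> (\<exists>r>0. dominated (hermite_coeff f) (weight r s))})"

definition pil_small :: "pil_order \<Rightarrow> (real ^ 'd::finite \<Rightarrow> complex) set" where
  "pil_small s =
     {f. L2_fun f \<and> hermite_series_rep f \<and> (\<forall>r>0. dominated (hermite_coeff f) (weight r s))}"

definition pil_dual :: "pil_order \<Rightarrow> (('d::finite \<Rightarrow> nat) \<Rightarrow> complex) set" where
  "pil_dual s = (if s = Ord 0 then UNIV else {c. \<forall>r>0. dominated c (weight' r s)})"

definition pil_small_dual :: "pil_order \<Rightarrow> (('d::finite \<Rightarrow> nat) \<Rightarrow> complex) set" where
  "pil_small_dual s = {c. \<exists>r>0. dominated c (weight' r s)}"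

definition pairing :: "(('d::finite \<Rightarrow> nat) \<Rightarrow> complex) \<Rightarrow> (real ^ 'd \<Rightarrow> complex) \<Rightarrow> complex" where
  "pairing c \<phi> = (\<Sum>\<^sub>\<infinity>\<alpha>. c \<alpha> * hermite_coeff \<phi> \<alpha>)"

definition join :: "real ^ 'm::finite \<Rightarrow> real ^ 'n::finite \<Rightarrow> real ^ ('m + 'n)" where
  "join x1 x2 = (\<chi> i. case i of Inl a \<Rightarrow> x1 $ a | Inr b \<Rightarrow> x2 $ b)"

definition tensor ::
  "(real ^ 'm::finite \<Rightarrow> complex) \<Rightarrow> (real ^ 'n::finite \<Rightarrow> complex) \<Rightarrow> real ^ ('m + 'n) \<Rightarrow> complex" where
  "tensor \<phi>1 \<phi>2 x = \<phi>1 (\<chi> a. x $ Inl a) * \<phi>2 (\<chi> b. x $ Inr b)"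

end

theory Submission
  imports "HOL-Probability.Distributions" Defs
begin

text \<open>
  The pairings see a function only through its Hermite coefficients, so the statement is really one
  about sequences on multi-indices, together with a dictionary between sequences and functions.
  A multi-index of dimension \<open>d\<^sub>1 + d\<^sub>2\<close> is a pair \<open>(\<alpha>, \<beta>)\<close>, coded as \<open>case_sum \<alpha> \<beta>\<close>, and the Hermite
  functions factor accordingly: \<open>h\<^sub>(\<alpha>,\<beta>)(x, y) = h\<^sub>\<alpha>(x) h\<^sub>\<beta>(y)\<close>.

  \<^bold>\<open>Sequences.\<close> The functional sought is \<open>f(\<alpha>, \<beta>) = f\<^sub>1(\<alpha>) f\<^sub>2(\<beta>)\<close>. If \<open>c\<close> are the coefficients of
  \<open>\<phi>\<close>, then all of \<open>\<langle>f, \<phi>\<rangle>\<close>, \<open>\<langle>f\<^sub>1, \<psi>\<^sub>1\<rangle>\<close> and \<open>\<langle>f\<^sub>2, \<psi>\<^sub>2\<rangle>\<close> are the double series of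
  \<open>f\<^sub>1(\<alpha>) f\<^sub>2(\<beta>) c(\<alpha>, \<beta>)\<close>, summed at once or as an iterated sum, so they agree by Fubini as soon as the
  series converges absolutely. For the same reason the tensor identity is the product of two
  absolutely convergent series. Uniqueness is seen by testing on \<open>h\<^sub>\<alpha> \<otimes> h\<^sub>\<beta>\<close>, which reads off \<open>f(\<alpha>, \<beta>)\<close>.
  All this uses only a few closure properties of the spaces involved: tensor products of dual
  sequences are dual sequences, and contracting a test sequence with a dual one in one of the two
  variables gives a test sequence. The locales \<open>sequence_dual_pair\<close> and \<open>tensor_dual_pairs\<close> isolate these
  properties, and \<open>tensor_product_of_functionals\<close> is the theorem in that generality.

  \<^bold>\<open>The dictionary.\<close> What makes it work is that \<open>h\<^sub>\<alpha>(x)\<close>, for fixed \<open>x\<close>, grows at most polynomially in \<open>\<alpha>\<close>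
  (\<open>poly_growth_hermite_fun\<close>), so that evaluation at a point is itself a dual sequence. Hence the Hermite
  series of a test sequence converges absolutely at every point, freezing one variable of \<open>\<phi>\<close> is
  again a contraction, and \<open>\<psi>\<^sub>1\<close>, \<open>\<psi>\<^sub>2\<close> come out as Hermite series of contracted sequences. That the
  coefficients of such a series, defined as \<open>L\<^sup>2\<close> inner products, are the given ones follows from
  orthonormality by integrating term by term (\<open>hermite_series_synthesis\<close>).

  \<^bold>\<open>The weights.\<close> It remains to check the closure properties in the three cases: finitely supported
  sequences against all sequences (\<open>s = 0\<close>), and the two families of weighted spaces, with the bound
  required for some parameter or for every parameter. Up to changing the parameter, the weights are
  submultiplicative with respect to \<open>(\<alpha>, \<beta>)\<close>, and the product of a weight and a dual weight is
  summable because dual weights outgrow every polynomial.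
\<close>

section \<open>Hermite functions of one variable\<close>

text \<open>
  The function \<open>H\<^sub>n(t) exp(- t\<^sup>2 / 2)\<close> with the physicists' Hermite polynomial \<open>H\<^sub>n\<close>. Leaving out the
  normalisation keeps square roots out of the recurrence and of all derivatives.
\<close>

fun hermite_unnorm :: "nat \<Rightarrow> real \<Rightarrow> real" where
  "hermite_unnorm 0 t = exp (- t\<^sup>2 / 2)"
| "hermite_unnorm (Suc 0) t = 2 * t * exp (- t\<^sup>2 / 2)"
| "hermite_unnorm (Suc (Suc n)) t = 2 * t * hermite_unnorm (Suc n) t - 2 * real (Suc n) * hermite_unnorm n t"

text \<open>
  The raising operator \<open>t - d/dt\<close>. Together with the recurrence it gives the differential
  equation, the norms, the orthogonality and the pointwise bound.
\<close>

lemma DERIV_hermite_unnorm: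
  "(hermite_unnorm n has_real_derivative t * hermite_unnorm n t - hermite_unnorm (Suc n) t) (at t)"
proof (induction n rule: induct_nat_012)
  case 0
  have "hermite_unnorm 0 = (\<lambda>t. exp (- t\<^sup>2 / 2))" by auto
  then show ?case by (auto intro!: derivative_eq_intros)
next
  case 1
  have "hermite_unnorm (Suc 0) = (\<lambda>t. 2 * t * exp (- t\<^sup>2 / 2))" by auto
  then show ?case by (auto intro!: derivative_eq_intros simp: power2_eq_square algebra_simps)
next
  case (ge2 n)
  have "hermite_unnorm (Suc (Suc n)) =
    (\<lambda>t. 2 * t * hermite_unnorm (Suc n) t - 2 * real (Suc n) * hermite_unnorm n t)" by auto
  moreover have "((\<lambda>t. 2 * t * hermite_unnorm (Suc n) t - 2 * real (Suc n) * hermite_unnorm n t)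
     has_real_derivative
      (2 * hermite_unnorm (Suc n) t + (t * hermite_unnorm (Suc n) t - hermite_unnorm (Suc (Suc n)) t) * (2 * t))
      - 2 * real (Suc n) * (t * hermite_unnorm n t - hermite_unnorm (Suc n) t)) (at t)"
    by (rule derivative_eq_intros ge2 refl | simp)+
  ultimately show ?case
    by (simp add: algebra_simps)
qed

lemmas DERIV_hermite_unnorm' [derivative_intros] = DERIV_chain2[OF DERIV_hermite_unnorm]

lemma isCont_hermite_unnorm: "isCont (hermite_unnorm n) t"
  using DERIV_hermite_unnorm DERIV_isCont by blast

lemma borel_measurable_hermite_unnorm [measurable]: "hermite_unnorm n \<in> borel_measurable borel"
  by (intro borel_measurable_continuous_onI continuous_at_imp_continuous_on ballI isCont_hermite_unnorm)

text \<open>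
  The Hermite differential equation \<open>u'' = (t\<^sup>2 - (2 n + 1)) u\<close>.
\<close>

lemma DERIV_hermite_unnorm_twice:
  "((\<lambda>t. t * hermite_unnorm n t - hermite_unnorm (Suc n) t) has_real_derivative
     (t\<^sup>2 - (2 * real n + 1)) * hermite_unnorm n t) (at t)"
  by (auto intro!: derivative_eq_intros simp: power2_eq_square algebra_simps)

text \<open>
  The link with the Rodrigues-type formula by which the Hermite functions are defined.
\<close>

lemma deriv_gauss_iterate:
  "((deriv ^^ n) (\<lambda>t. exp (- t\<^sup>2))) = (\<lambda>t. (-1) ^ n * exp (- t\<^sup>2 / 2) * hermite_unnorm n t)"
proof (induction n)
  case 0
  show ?case by (simp add: mult_exp_exp)
next
  case (Suc n)
  have "((\<lambda>t. (-1) ^ n * exp (- t\<^sup>2 / 2) * hermite_unnorm n t) has_real_derivative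
     (-1) ^ Suc n * exp (- t\<^sup>2 / 2) * hermite_unnorm (Suc n) t) (at t)" for t
    by (auto intro!: derivative_eq_intros simp: algebra_simps)
  then show ?case using Suc by (auto intro!: DERIV_imp_deriv)
qed

lemma abs_le_exp_square:
  fixes t e :: real
  assumes e: "e > 0"
  shows "\<bar>t\<bar> \<le> (1 + 1 / e) * exp (e * t\<^sup>2)"
proof -
  have "\<bar>t\<bar> \<le> 1 + t\<^sup>2" using sum_squares_bound[of "\<bar>t\<bar>" 1] by (simp; smt (verit) zero_le_power2)
  also have "\<dots> \<le> (1 + 1 / e) * (1 + e * t\<^sup>2)"
    using e by (simp add: field_simps)
  also have "\<dots> \<le> (1 + 1 / e) * exp (e * t\<^sup>2)"
    using e by (intro mult_left_mono) (auto simp: exp_ge_add_one_self)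
  finally show ?thesis .
qed

text \<open>
  Quantified over all rates \<open>b < 1 / 2\<close>, so that in the recurrence the factor \<open>t\<close> can be absorbed by
  using the induction hypothesis at a slightly larger rate.
\<close>

lemma hermite_unnorm_gauss_bound:
  fixes b :: real
  assumes "b < 1 / 2"
  shows "\<exists>C. \<forall>t. \<bar>hermite_unnorm n t\<bar> \<le> C * exp (- b * t\<^sup>2)"
  using assms
proof (induction n arbitrary: b rule: induct_nat_012)
  case 0
  have "\<bar>hermite_unnorm 0 t\<bar> \<le> 1 * exp (- b * t\<^sup>2)" for t
    using 0 mult_right_mono[of b "1/2" "t\<^sup>2"] by simp
  then show ?case by blast
next
  case 1
  define e where "e = 1/2 - b"
  have e: "e > 0" "b + e = 1/2" using 1 by (auto simp: e_def)
  note t = abs_le_exp_square[OF e(1)]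
  have "\<bar>hermite_unnorm 1 t\<bar> \<le> (2 * (1 + 1 / e)) * exp (- b * t\<^sup>2)" for t
  proof -
    have "\<bar>hermite_unnorm 1 t\<bar> = 2 * \<bar>t\<bar> * exp (- t\<^sup>2 / 2)" by (simp add: abs_mult)
    also have "\<dots> \<le> 2 * ((1 + 1 / e) * exp (e * t\<^sup>2)) * exp (- t\<^sup>2 / 2)"
      using t by (intro mult_right_mono mult_left_mono) auto
    also have "\<dots> = (2 * (1 + 1 / e)) * exp (- b * t\<^sup>2)"
      by (simp add: e_def mult_exp_exp algebra_simps)
    finally show ?thesis .
  qed
  then show ?case by auto
next
  case (ge2 n)
  define e where "e = (1/2 - b) / 2"
  have e: "e > 0" "b + e < 1/2" using ge2.prems by (simp_all add: e_def field_simps)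
  note t = abs_le_exp_square[OF e(1)]
  obtain C1 where C1: "\<And>t. \<bar>hermite_unnorm n t\<bar> \<le> C1 * exp (- b * t\<^sup>2)"
    using ge2 by blast
  obtain C2 where C2: "\<And>t. \<bar>hermite_unnorm (Suc n) t\<bar> \<le> C2 * exp (- (b + e) * t\<^sup>2)"
    using ge2 e by blast
  have "\<bar>hermite_unnorm (Suc (Suc n)) t\<bar> \<le> (2 * (1 + 1 / e) * C2 + 2 * real (Suc n) * C1) * exp (- b * t\<^sup>2)" for t
  proof -
    have "\<bar>hermite_unnorm (Suc (Suc n)) t\<bar> \<le> 2 * (\<bar>t\<bar> * \<bar>hermite_unnorm (Suc n) t\<bar>) + 2 * real (Suc n) * \<bar>hermite_unnorm n t\<bar>"
      by (simp only: hermite_unnorm.simps) (rule order.trans[OF abs_triangle_ineq4], simp add: abs_mult)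
    also have "\<dots> \<le> 2 * (((1 + 1 / e) * exp (e * t\<^sup>2)) * (C2 * exp (- (b + e) * t\<^sup>2)))
      + 2 * real (Suc n) * (C1 * exp (- b * t\<^sup>2))"
      using e by (intro add_mono mult_left_mono mult_mono t C1 C2) auto
    also have "\<dots> = (2 * (1 + 1 / e) * C2 + 2 * real (Suc n) * C1) * exp (- b * t\<^sup>2)"
    proof -
      have "exp (- b * t\<^sup>2) = exp (e * t\<^sup>2) * exp (- (b + e) * t\<^sup>2)"
        by (simp add: mult_exp_exp algebra_simps)
      then show ?thesis by (simp add: algebra_simps)
    qed
    finally show ?thesis .
  qed
  then show ?case by blast
qed

lemma hermite_unnorm_prod_bound:
  obtains C where "\<And>t. \<bar>hermite_unnorm n t * hermite_unnorm m t\<bar> \<le> C * exp (- t\<^sup>2 / 2)"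
proof -
  obtain C1 where C1: "\<And>t. \<bar>hermite_unnorm n t\<bar> \<le> C1 * exp (- (1/4) * t\<^sup>2)"
    using hermite_unnorm_gauss_bound[of "1/4" n] by auto
  obtain C2 where C2: "\<And>t. \<bar>hermite_unnorm m t\<bar> \<le> C2 * exp (- (1/4) * t\<^sup>2)"
    using hermite_unnorm_gauss_bound[of "1/4" m] by auto
  have "C1 \<ge> 0" using C1[of 0] by simp
  have "\<bar>hermite_unnorm n t * hermite_unnorm m t\<bar> \<le> (C1 * C2) * exp (- t\<^sup>2 / 2)" for t
  proof -
    have "\<bar>hermite_unnorm n t * hermite_unnorm m t\<bar>
        \<le> (C1 * exp (- (1/4) * t\<^sup>2)) * (C2 * exp (- (1/4) * t\<^sup>2))"
      unfolding abs_mult using \<open>C1 \<ge> 0\<close> by (intro mult_mono C1 C2) auto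
    also have "\<dots> = (C1 * C2) * (exp (- (1/4) * t\<^sup>2) * exp (- (1/4) * t\<^sup>2))" by (simp add: algebra_simps)
    also have "exp (- (1/4) * t\<^sup>2) * exp (- (1/4) * t\<^sup>2) = exp (- t\<^sup>2 / 2)"
      unfolding mult_exp_exp by (rule arg_cong[where f = exp]) (simp add: algebra_simps)
    finally show ?thesis .
  qed
  then show ?thesis using that by blast
qed

lemma has_bochner_integral_gauss:
  "has_bochner_integral lborel (\<lambda>t::real. exp (- t\<^sup>2)) (sqrt pi)"
  using has_bochner_integral_even_function[OF gaussian_moment_0] by simp

lemma integrable_gauss_half: "integrable lborel (\<lambda>t::real. exp (- t\<^sup>2 / 2))"
proof -
  have "integrable lborel (\<lambda>t. sqrt (2 * pi) * std_normal_density t)"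
    by (intro integrable_mult_right integrable_normal_density) simp
  then show ?thesis by (simp add: std_normal_density_def)
qed

lemma integrable_hermite_unnorm_prod:
  "integrable lborel (\<lambda>t. hermite_unnorm n t * hermite_unnorm m t)"
proof -
  obtain C where "\<And>t. \<bar>hermite_unnorm n t * hermite_unnorm m t\<bar> \<le> C * exp (- t\<^sup>2 / 2)"
    using hermite_unnorm_prod_bound by blast
  then have "norm (hermite_unnorm n t * hermite_unnorm m t) \<le> norm (C * exp (- t\<^sup>2 / 2))" for t
    unfolding real_norm_def by (rule order.trans[OF _ abs_ge_self])
  moreover have "integrable lborel (\<lambda>t::real. C * exp (- t\<^sup>2 / 2))"
    using integrable_gauss_half by (rule integrable_mult_right)
  ultimately show ?thesis
    by (rule_tac Bochner_Integration.integrable_bound[where f = "\<lambda>t. C * exp (- t\<^sup>2 / 2)"]) auto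
qed

lemma tendsto_hermite_unnorm_prod:
  assumes "filterlim f at_infinity F"
  shows "((\<lambda>x. hermite_unnorm n (f x) * hermite_unnorm m (f x)) \<longlongrightarrow> 0) F"
proof -
  obtain C where C: "\<And>t. \<bar>hermite_unnorm n t * hermite_unnorm m t\<bar> \<le> C * exp (- t\<^sup>2 / 2)"
    using hermite_unnorm_prod_bound by blast
  have "filterlim (\<lambda>x. \<bar>f x\<bar>) at_top F"
    using assms filterlim_at_infinity_imp_norm_at_top by fastforce
  then have "filterlim (\<lambda>x. \<bar>f x\<bar> ^ 2) at_top F"
    by (intro filterlim_pow_at_top) auto
  then have "filterlim (\<lambda>x. 1/2 * \<bar>f x\<bar>^2) at_top F"
    by (intro filterlim_tendsto_pos_mult_at_top[OF tendsto_const]) auto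
  then have "filterlim (\<lambda>x. - (1/2 * \<bar>f x\<bar>^2)) at_bot F"
    by (simp add: filterlim_uminus_at_bot)
  then have "((\<lambda>x. C * exp (- (1/2 * \<bar>f x\<bar>^2))) \<longlongrightarrow> C * 0) F"
    by (intro tendsto_mult tendsto_const filterlim_compose[OF exp_at_bot])
  then have "((\<lambda>x. C * exp (- (f x)\<^sup>2 / 2)) \<longlongrightarrow> 0) F" by simp
  then show ?thesis
    by (rule Lim_null_comparison[rotated]) (use C in \<open>auto intro!: always_eventually\<close>)
qed

lemmas tendsto_hermite_unnorm_prod_at_top =
  tendsto_hermite_unnorm_prod[OF filterlim_mono[OF filterlim_ident at_top_le_at_infinity order.refl]]
lemmas tendsto_hermite_unnorm_prod_at_bot =
  tendsto_hermite_unnorm_prod[OF filterlim_mono[OF filterlim_ident at_bot_le_at_infinity order.refl]]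

text \<open>
  The orthogonality relations and the norms are all obtained by exhibiting an integrand as the
  derivative of a combination of products of two Hermite functions, which vanishes at infinity.
\<close>

lemma integral_derivative_eq_0:
  fixes F f :: "real \<Rightarrow> real"
  assumes "\<And>t. (F has_real_derivative f t) (at t)" "\<And>t. isCont f t" "integrable lborel f"
    and "(F \<longlongrightarrow> 0) at_top" "(F \<longlongrightarrow> 0) at_bot"
  shows "(LINT t|lborel. f t) = 0"
proof -
  have "(LBINT t=-\<infinity>..\<infinity>. f t) = 0 - 0"
  proof (rule interval_integral_FTC_integrable)
    show "((F \<circ> real_of_ereal) \<longlongrightarrow> 0) (at_right (- \<infinity>))" "((F \<circ> real_of_ereal) \<longlongrightarrow> 0) (at_left \<infinity>)"
      using assms by (simp_all add: ereal_tendsto_simps)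
    show "set_integrable lborel (einterval (- \<infinity>) \<infinity>) f"
      using assms by (simp add: set_integrable_def einterval_eq_UNIV)
  qed (use assms in \<open>auto simp: has_real_derivative_iff_has_vector_derivative[symmetric]\<close>)
  then show ?thesis
    by (simp add: interval_lebesgue_integral_def einterval_eq_UNIV set_lebesgue_integral_def)
qed

text \<open>
  With \<open>u\<^sub>n\<close> the unnormalised functions, \<open>(u\<^sub>n u\<^sub>n\<^sub>+\<^sub>1)' = 2 (n + 1) u\<^sub>n\<^sup>2 - u\<^sub>n\<^sub>+\<^sub>1\<^sup>2\<close>.
\<close>

lemma hermite_unnorm_norm_step:
  "(LINT t|lborel. (hermite_unnorm (Suc n) t)\<^sup>2) = 2 * real (Suc n) * (LINT t|lborel. (hermite_unnorm n t)\<^sup>2)"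
proof -
  have i: "integrable lborel (\<lambda>t. (hermite_unnorm n t)\<^sup>2)" for n
    using integrable_hermite_unnorm_prod[of n n] by (simp add: power2_eq_square)
  have "(LINT t|lborel. 2 * real (Suc n) * (hermite_unnorm n t)\<^sup>2 - (hermite_unnorm (Suc n) t)\<^sup>2) = 0"
  proof (rule integral_derivative_eq_0)
    show "((\<lambda>t. hermite_unnorm n t * hermite_unnorm (Suc n) t) has_real_derivative
       2 * real (Suc n) * (hermite_unnorm n t)\<^sup>2 - (hermite_unnorm (Suc n) t)\<^sup>2) (at t)" for t
      by (rule derivative_eq_intros DERIV_hermite_unnorm refl)+ (simp add: power2_eq_square algebra_simps)
    show "isCont (\<lambda>t. 2 * real (Suc n) * (hermite_unnorm n t)\<^sup>2 - (hermite_unnorm (Suc n) t)\<^sup>2) t" for t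
      by (intro continuous_intros isCont_hermite_unnorm)
    show "integrable lborel (\<lambda>t. 2 * real (Suc n) * (hermite_unnorm n t)\<^sup>2 - (hermite_unnorm (Suc n) t)\<^sup>2)"
      using i[of n] i[of "Suc n"] by (intro Bochner_Integration.integrable_diff integrable_mult_right)
  qed (rule tendsto_hermite_unnorm_prod_at_top tendsto_hermite_unnorm_prod_at_bot)+
  then show ?thesis using i by simp
qed

lemma hermite_unnorm_norm:
  "(LINT t|lborel. (hermite_unnorm n t)\<^sup>2) = sqrt pi * (2 ^ n * fact n)"
proof (induction n)
  case 0
  have "(hermite_unnorm 0 t)\<^sup>2 = exp (- t\<^sup>2)" for t
    by (simp add: power2_eq_square mult_exp_exp)
  then show ?case
    using has_bochner_integral_integral_eq[OF has_bochner_integral_gauss] by simp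
next
  case (Suc n)
  then show ?case by (subst hermite_unnorm_norm_step) simp
qed

text \<open>
  The Wronskian of two solutions of the differential equation with different eigenvalues has
  derivative \<open>2 (m - n) u\<^sub>n u\<^sub>m\<close>.
\<close>

lemma hermite_unnorm_orthogonal:
  assumes "n \<noteq> m"
  shows "(LINT t|lborel. hermite_unnorm n t * hermite_unnorm m t) = 0"
proof -
  have "(LINT t|lborel. 2 * (real m - real n) * (hermite_unnorm n t * hermite_unnorm m t)) = 0"
  proof (rule integral_derivative_eq_0)
    show "((\<lambda>t. hermite_unnorm n t * hermite_unnorm (Suc m) t - hermite_unnorm (Suc n) t * hermite_unnorm m t) has_real_derivative
       2 * (real m - real n) * (hermite_unnorm n t * hermite_unnorm m t)) (at t)" for t
      by (rule derivative_eq_intros DERIV_hermite_unnorm refl)+ (simp add: power2_eq_square algebra_simps)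
    show "isCont (\<lambda>t. 2 * (real m - real n) * (hermite_unnorm n t * hermite_unnorm m t)) t" for t
      by (intro continuous_intros isCont_hermite_unnorm)
    show "((\<lambda>t. hermite_unnorm n t * hermite_unnorm (Suc m) t - hermite_unnorm (Suc n) t * hermite_unnorm m t) \<longlongrightarrow> 0) at_top"
      using tendsto_diff[OF tendsto_hermite_unnorm_prod_at_top[of n "Suc m"] tendsto_hermite_unnorm_prod_at_top[of "Suc n" m]]
      by (simp del: hermite_unnorm.simps)
    show "((\<lambda>t. hermite_unnorm n t * hermite_unnorm (Suc m) t - hermite_unnorm (Suc n) t * hermite_unnorm m t) \<longlongrightarrow> 0) at_bot"
      using tendsto_diff[OF tendsto_hermite_unnorm_prod_at_bot[of n "Suc m"] tendsto_hermite_unnorm_prod_at_bot[of "Suc n" m]]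
      by (simp del: hermite_unnorm.simps)
    show "integrable lborel (\<lambda>t. 2 * (real m - real n) * (hermite_unnorm n t * hermite_unnorm m t))"
      using integrable_hermite_unnorm_prod by (rule integrable_mult_right)
  qed
  with assms show ?thesis by simp
qed

definition hermite1 :: "nat \<Rightarrow> real \<Rightarrow> real" where
  "hermite1 n t = hermite_unnorm n t / sqrt (sqrt pi * (2 ^ n * fact n))"

lemma borel_measurable_hermite1 [measurable]: "hermite1 n \<in> borel_measurable borel"
  unfolding hermite1_def by measurable

lemma integrable_hermite1_prod: "integrable lborel (\<lambda>t. hermite1 n t * hermite1 m t)"
proof -
  have "integrable lborel (\<lambda>t. hermite_unnorm n t * hermite_unnorm m t
     / (sqrt (sqrt pi * (2 ^ n * fact n)) * sqrt (sqrt pi * (2 ^ m * fact m))))"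
    by (intro integrable_divide_zero integrable_hermite_unnorm_prod)
  then show ?thesis by (simp add: hermite1_def)
qed

lemma hermite1_orthonormal:
  "(LINT t|lborel. hermite1 n t * hermite1 m t) = (if n = m then 1 else 0)"
proof -
  have "(LINT t|lborel. hermite1 n t * hermite1 m t) =
    (LINT t|lborel. hermite_unnorm n t * hermite_unnorm m t)
     / (sqrt (sqrt pi * (2 ^ n * fact n)) * sqrt (sqrt pi * (2 ^ m * fact m)))"
    by (simp add: hermite1_def)
  also have "\<dots> = (if n = m then 1 else 0)"
    using hermite_unnorm_orthogonal[of n m] hermite_unnorm_norm[of n]
    by (auto simp: power2_eq_square)
  finally show ?thesis .
qed

lemma hermite_unnorm_0_bound: "(hermite_unnorm n 0)\<^sup>2 \<le> 2 ^ n * fact n"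
proof (induction n rule: induct_nat_012)
  case (ge2 n)
  have "(hermite_unnorm (Suc (Suc n)) 0)\<^sup>2 = 4 * (real (Suc n))\<^sup>2 * (hermite_unnorm n 0)\<^sup>2"
    by (simp add: power2_eq_square algebra_simps)
  also have "\<dots> \<le> 4 * (real (Suc n) * real (Suc (Suc n))) * (2 ^ n * fact n)"
    by (intro mult_mono ge2) (auto simp: power2_eq_square)
  also have "\<dots> = 2 ^ Suc (Suc n) * fact (Suc (Suc n))"
    by simp
  finally show ?case .
qed auto

text \<open>
  By the differential equation, the energy \<open>u'\<^sup>2 + (2 n + 1 - t\<^sup>2) u\<^sup>2\<close> has derivative \<open>- 2 t u\<^sup>2\<close>. So it is
  largest at \<open>t = 0\<close>, where the middle term of the recurrence drops out and both squares are bounded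
  by induction.
\<close>

lemma hermite_unnorm_energy_bound:
  "(2 * real n + 1 - t\<^sup>2) * (hermite_unnorm n t)\<^sup>2 \<le> (4 * real n + 3) * (2 ^ n * fact n)"
proof -
  define d where "d t = t * hermite_unnorm n t - hermite_unnorm (Suc n) t" for t
  define E where "E t = (d t)\<^sup>2 + (2 * real n + 1 - t\<^sup>2) * (hermite_unnorm n t)\<^sup>2" for t
  have D: "(d has_real_derivative (t\<^sup>2 - (2 * real n + 1)) * hermite_unnorm n t) (at t)"
     "(hermite_unnorm n has_real_derivative d t) (at t)" for t
    unfolding d_def using DERIV_hermite_unnorm_twice DERIV_hermite_unnorm by blast+
  have E: "(E has_real_derivative (- 2 * t * (hermite_unnorm n t)\<^sup>2)) (at t)" for t
    unfolding E_def
    by (rule derivative_eq_intros D refl)+ (simp add: power2_eq_square algebra_simps)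
  have "E t \<le> E 0"
  proof (cases "t \<ge> 0")
    case True
    then show ?thesis
      by (rule DERIV_nonpos_imp_nonincreasing) (use E in \<open>fastforce intro: mult_nonneg_nonneg\<close>)
  next
    case False
    then have "t \<le> 0" by simp
    then show ?thesis
      by (rule DERIV_nonneg_imp_nondecreasing)
         (use E in \<open>fastforce intro: mult_nonpos_nonneg simp: mult_le_0_iff\<close>)
  qed
  also have "E 0 = (hermite_unnorm (Suc n) 0)\<^sup>2 + (2 * real n + 1) * (hermite_unnorm n 0)\<^sup>2"
    by (simp add: E_def d_def)
  also have "\<dots> \<le> 2 ^ Suc n * fact (Suc n) + (2 * real n + 1) * (2 ^ n * fact n)"
    by (intro add_mono mult_left_mono hermite_unnorm_0_bound) auto
  also have "\<dots> = (4 * real n + 3) * (2 ^ n * fact n)" by (simp add: algebra_simps)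
  finally show ?thesis by (simp add: E_def; smt (verit) zero_le_power2)
qed

text \<open>
  The energy bound controls \<open>h\<^sub>n(t)\<close> as soon as \<open>n \<ge> t\<^sup>2\<close>, and only finitely many \<open>n\<close> remain for a
  given \<open>t\<close>. The constant depends on \<open>t\<close>, which is harmless for the pointwise convergence of Hermite
  series.
\<close>

lemma hermite1_pointwise_bound:
  obtains C where "C \<ge> 1" "\<And>n. \<bar>hermite1 n t\<bar> \<le> C * (1 + real n)"
proof -
  obtain N :: nat where N: "real N \<ge> t\<^sup>2" using real_arch_simple by blast
  \<comment> \<open>the sum bounds the terms with \<open>n < N\<close>, the constant \<open>2\<close> comes from the energy bound for \<open>n \<ge> N\<close>\<close>
  define C where "C = 2 + (\<Sum>n<N. \<bar>hermite1 n t\<bar>)"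
  have C: "C \<ge> 2" unfolding C_def by (simp add: sum_nonneg)
  have "\<bar>hermite1 n t\<bar> \<le> C * (1 + real n)" for n
  proof (cases "n < N")
    case True
    have "\<bar>hermite1 n t\<bar> \<le> (\<Sum>n<N. \<bar>hermite1 n t\<bar>)"
      using True by (intro member_le_sum) auto
    also have "\<dots> \<le> C * 1" by (simp add: C_def)
    also have "\<dots> \<le> C * (1 + real n)" using C by (intro mult_left_mono) auto
    finally show ?thesis .
  next
    case False
    let ?w = "2 ^ n * fact n :: real"
    have "1 * (hermite_unnorm n t)\<^sup>2 \<le> (2 * real n + 1 - t\<^sup>2) * (hermite_unnorm n t)\<^sup>2"
      using False N by (intro mult_right_mono) auto
    also have "\<dots> \<le> (4 * real n + 3) * ?w" by (rule hermite_unnorm_energy_bound)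
    finally have 1: "(hermite_unnorm n t)\<^sup>2 \<le> (4 * real n + 3) * ?w" by simp
    have "(hermite1 n t)\<^sup>2 = (hermite_unnorm n t)\<^sup>2 / (sqrt pi * ?w)"
      by (simp add: hermite1_def power_divide)
    also have "\<dots> \<le> ((4 * real n + 3) * ?w) / (1 * ?w)"
      using pi_ge_two by (intro frac_le mult_right_mono 1) auto
    also have "\<dots> = 4 * real n + 3" by simp
    also have "\<dots> \<le> (2 * (1 + real n))\<^sup>2" by (simp add: power2_eq_square algebra_simps)
    finally have "\<bar>hermite1 n t\<bar> \<le> 2 * (1 + real n)"
      by (rule power2_le_imp_le[of "\<bar>hermite1 n t\<bar>", simplified]) simp
    also have "\<dots> \<le> C * (1 + real n)" using C by (intro mult_right_mono) auto
    finally show ?thesis .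
  qed
  then show ?thesis using that[of C] C by simp
qed

section \<open>Hermite functions of several variables\<close>

lemma DERIV_gauss_iterate:
  "((deriv ^^ n) (\<lambda>t. exp (- t\<^sup>2)) has_real_derivative (deriv ^^ Suc n) (\<lambda>t. exp (- t\<^sup>2)) t) (at t)"
proof -
  have "((\<lambda>t. (-1) ^ n * exp (- t\<^sup>2 / 2) * hermite_unnorm n t) has_real_derivative
     (-1) ^ Suc n * exp (- t\<^sup>2 / 2) * hermite_unnorm (Suc n) t) (at t)"
    by (auto intro!: derivative_eq_intros simp: algebra_simps)
  then show ?thesis by (simp only: deriv_gauss_iterate)
qed

definition gauss_deriv :: "('d::finite \<Rightarrow> nat) \<Rightarrow> real ^ 'd \<Rightarrow> real" where
  "gauss_deriv \<beta> x = (\<Prod>j\<in>UNIV. (deriv ^^ \<beta> j) (\<lambda>t. exp (- t\<^sup>2)) (x $ j))"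

lemma partial_deriv_gauss_deriv:
  "partial_deriv i (gauss_deriv \<beta>) = gauss_deriv (\<beta>(i := Suc (\<beta> i)))"
proof
  fix x :: "real ^ 'a"
  let ?g = "\<lambda>n. (deriv ^^ n) (\<lambda>t::real. exp (- t\<^sup>2))"
  let ?R = "\<Prod>j\<in>UNIV-{i}. ?g (\<beta> j) (x $ j)"
  have 1: "gauss_deriv \<beta> (x + t *\<^sub>R axis i 1) = ?g (\<beta> i) (x $ i + t) * ?R" for t
    unfolding gauss_deriv_def
    by (subst prod.remove[of UNIV i]) (auto simp: axis_def intro!: arg_cong2[where f = "(*)"] prod.cong)
  have "((\<lambda>t. ?g (\<beta> i) (x $ i + t) * ?R) has_real_derivative
      (?g (Suc (\<beta> i)) (x $ i + 0) * (0 + 1)) * ?R) (at 0)"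
    by (intro DERIV_cmult_right DERIV_chain2[OF DERIV_gauss_iterate]) (auto intro!: derivative_eq_intros)
  then have "partial_deriv i (gauss_deriv \<beta>) x = ?g (Suc (\<beta> i)) (x $ i) * ?R"
    unfolding partial_deriv_def 1 by (simp add: DERIV_imp_deriv)
  also have "\<dots> = gauss_deriv (\<beta>(i := Suc (\<beta> i))) x"
    unfolding gauss_deriv_def
    by (subst prod.remove[of UNIV i]) (auto intro!: arg_cong2[where f = "(*)"] prod.cong)
  finally show "partial_deriv i (gauss_deriv \<beta>) x = gauss_deriv (\<beta>(i := Suc (\<beta> i))) x" .
qed

text \<open>
  For the Gaussian, differentiating in one coordinate changes one factor of a product, so the order
  chosen in \<open>coords\<close> does not matter. Along the enumeration, the orders of differentiation already
  applied are \<open>\<alpha>\<close> on the coordinates visited and \<open>0\<close> on the others.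
\<close>

lemma multi_deriv_gauss: "multi_deriv \<alpha> (\<lambda>y. exp (- (norm y)\<^sup>2)) = gauss_deriv \<alpha>"
proof -
  have pw: "(partial_deriv i ^^ k) (gauss_deriv \<beta>) = gauss_deriv (\<beta>(i := \<beta> i + k))"
    for i k and \<beta> :: "'a \<Rightarrow> nat"
    by (induction k) (simp_all add: partial_deriv_gauss_deriv fun_upd_def cong: if_cong)
  have "distinct xs \<Longrightarrow> foldr (\<lambda>i. partial_deriv i ^^ \<alpha> i) xs (gauss_deriv (\<lambda>_. 0))
     = gauss_deriv (\<lambda>i. if i \<in> set xs then \<alpha> i else 0)" for xs
  proof (induction xs)
    case (Cons i xs)
    then show ?case by (auto simp: pw intro!: arg_cong[where f = gauss_deriv])
  qed simp
  moreover have "distinct (coords :: 'a list) \<and> set (coords :: 'a list) = UNIV"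
    unfolding coords_def
    by (rule someI_ex) (use finite_distinct_list[OF finite_class.finite_UNIV] in blast)
  moreover have "(\<lambda>y :: real ^ 'a. exp (- (norm y)\<^sup>2)) = gauss_deriv (\<lambda>_. 0)"
    by (auto simp: gauss_deriv_def norm_vec_def L2_set_def sum_nonneg exp_sum sum_negf[symmetric])
  ultimately show ?thesis by (simp add: multi_deriv_def)
qed

lemma hermite1_eq_gauss_iterate:
  "hermite1 n t = pi powr (- 1 / 4) * (-1) ^ n * (2 ^ n * fact n) powr (- 1 / 2) * exp (t\<^sup>2 / 2)
      * (deriv ^^ n) (\<lambda>t. exp (- t\<^sup>2)) t"
proof -
  define w :: real where "w = 2 ^ n * fact n"
  have "w > 0" by (simp add: w_def)
  have "sqrt (sqrt pi) = (pi powr (1 / 2)) powr (1 / 2)"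
    by (simp add: powr_half_sqrt)
  also have "\<dots> = pi powr (1 / 4)" by (simp only: powr_powr) simp
  finally have "sqrt (sqrt pi * w) = pi powr (1 / 4) * w powr (1 / 2)"
    using \<open>w > 0\<close> by (simp add: real_sqrt_mult powr_half_sqrt)
  then have "hermite1 n t = pi powr (- (1 / 4)) * w powr (- (1 / 2)) * hermite_unnorm n t"
    unfolding hermite1_def w_def[symmetric] by (simp only: powr_minus divide_inverse inverse_mult_distrib mult_ac)
  moreover have "(-1) ^ n * exp (t\<^sup>2 / 2) * ((-1) ^ n * exp (- t\<^sup>2 / 2) * hermite_unnorm n t) = hermite_unnorm n t"
  proof -
    have "(-1) ^ n * (-1) ^ n = (1::real)" by (simp flip: power_mult_distrib)
    moreover have "exp (t\<^sup>2 / 2) * exp (- t\<^sup>2 / 2) = 1" by (simp add: mult_exp_exp)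
    ultimately show ?thesis by (metis (no_types, opaque_lifting) mult.assoc mult.left_commute mult_1)
  qed
  moreover have "pi powr (- 1 / 4) * (-1) ^ n * w powr (- 1 / 2) * exp (t\<^sup>2 / 2) * X
      = pi powr (- (1 / 4)) * w powr (- (1 / 2)) * ((-1) ^ n * exp (t\<^sup>2 / 2) * X)" for X
    by (simp only: mult_ac minus_divide_left)
  ultimately show ?thesis
    unfolding deriv_gauss_iterate w_def[symmetric] by simp
qed

lemma hermite_fun_eq_prod: "hermite_fun \<alpha> x = (\<Prod>i\<in>UNIV. hermite1 (\<alpha> i) (x $ i))"
proof -
  have p: "pi powr (- real CARD('a) / 4) = (\<Prod>i\<in>(UNIV :: 'a set). pi powr (- 1 / 4))"
    by (simp add: powr_realpow[symmetric] powr_powr)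
  have "2 ^ mlength \<alpha> * real (mfact \<alpha>) = (\<Prod>i\<in>UNIV. 2 ^ \<alpha> i * fact (\<alpha> i))"
    by (simp add: mlength_def mfact_def power_sum prod.distrib)
  then have w: "(2 ^ mlength \<alpha> * real (mfact \<alpha>)) powr (- 1 / 2) = (\<Prod>i\<in>UNIV. (2 ^ \<alpha> i * fact (\<alpha> i)) powr (- 1 / 2))"
    by (simp only: prod_powr_distrib)
  have e: "exp ((norm x)\<^sup>2 / 2) = (\<Prod>i\<in>UNIV. exp ((x $ i)\<^sup>2 / 2))"
    by (simp add: norm_vec_def L2_set_def sum_nonneg exp_sum[symmetric] sum_divide_distrib)
  have m: "(-1) ^ mlength \<alpha> = (\<Prod>i\<in>UNIV. (-1 :: real) ^ \<alpha> i)"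
    by (simp add: mlength_def power_sum)
  show ?thesis
    unfolding hermite_fun_def hermite1_eq_gauss_iterate multi_deriv_gauss gauss_deriv_def p w e m
    by (simp only: prod.distrib)
qed

lemma borel_measurable_hermite_fun [measurable]: "hermite_fun \<alpha> \<in> borel_measurable borel"
proof -
  have "(\<lambda>x. hermite_fun \<alpha> x) \<in> borel_measurable borel"
    unfolding hermite_fun_eq_prod by measurable
  then show ?thesis by simp
qed

text \<open>
  Fubini for products of functions of one coordinate each: Lebesgue measure on the Euclidean space is
  the image of the product measure indexed by its standard basis, and the basis is in turn indexed by
  the coordinates.
\<close>

lemma
  fixes g :: "'d::finite \<Rightarrow> real \<Rightarrow> real"
  assumes g: "\<And>i. integrable lborel (g i)"
  shows integrable_prod_coord: "integrable lborel (\<lambda>x::real ^ 'd. \<Prod>i\<in>UNIV. g i (x $ i))"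
    and integral_prod_coord: "(LINT x|lborel. (\<Prod>i\<in>UNIV. g i (x $ i))) = (\<Prod>i\<in>UNIV. (LINT t|lborel. g i t))"
proof -
  \<comment> \<open>\<open>idx\<close> is the inverse of \<open>\<lambda>i. axis i 1\<close> on the basis\<close>
  define idx :: "real ^ 'd \<Rightarrow> 'd" where "idx b = (SOME i. b = axis i 1)" for b
  have idx: "idx (axis i 1) = i" for i
    unfolding idx_def by (rule some_equality) (auto simp: axis_eq_axis)
  have B: "(Basis :: (real ^ 'd) set) = (\<lambda>i. axis i 1) ` UNIV"
    by (auto simp: Basis_vec_def)
  have inj: "inj (\<lambda>i. axis i (1::real) :: real ^ 'd)"
    by (auto simp: inj_on_def axis_eq_axis)
  have [measurable]: "g i \<in> borel_measurable borel" for i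
    using borel_measurable_integrable[OF g[of i]] by simp
  have T [measurable]: "(\<lambda>f. \<Sum>b\<in>Basis. f b *\<^sub>R b) \<in> (\<Pi>\<^sub>M b\<in>Basis. lborel) \<rightarrow>\<^sub>M (borel :: (real ^ 'd) measure)"
    by measurable
  have *: "(\<Prod>i\<in>UNIV. g i ((\<Sum>b\<in>Basis. f b *\<^sub>R b) $ i)) = (\<Prod>b\<in>Basis. g (idx b) (f b))"
    for f :: "real ^ 'd \<Rightarrow> real"
  proof -
    have "(\<Sum>b\<in>Basis. f b *\<^sub>R b) $ i = f (axis i 1)" for i
      using inner_sum_left_Basis[of "axis i 1" f]
      by (simp add: B inner_axis)
    then show ?thesis by (simp add: B prod.reindex[OF inj] idx o_def)
  qed
  interpret product_sigma_finite "\<lambda>_ :: real ^ 'd. lborel :: real measure" ..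
  have f [measurable]: "(\<lambda>x::real ^ 'd. \<Prod>i\<in>UNIV. g i (x $ i)) \<in> borel_measurable borel"
    by measurable
  show "integrable lborel (\<lambda>x::real ^ 'd. \<Prod>i\<in>UNIV. g i (x $ i))"
    unfolding lborel_eq[where 'a = "real ^ 'd"] integrable_distr_eq[OF T f] *
    by (intro product_integrable_prod g) simp
  have "(LINT x|lborel. (\<Prod>i\<in>UNIV. g i (x $ i)))
      = (\<Prod>b\<in>(Basis :: (real ^ 'd) set). (LINT t|lborel. g (idx b) t))"
    unfolding lborel_eq[where 'a = "real ^ 'd"] integral_distr[OF T f] *
    by (intro product_integral_prod g) simp
  also have "\<dots> = (\<Prod>i\<in>UNIV. (LINT t|lborel. g i t))"
    by (simp add: B prod.reindex[OF inj] idx o_def)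
  finally show "(LINT x|lborel. (\<Prod>i\<in>UNIV. g i (x $ i))) = (\<Prod>i\<in>UNIV. (LINT t|lborel. g i t))" .
qed

lemma integrable_hermite_fun_prod: "integrable lborel (\<lambda>x. hermite_fun \<alpha> x * hermite_fun \<beta> x)"
  unfolding hermite_fun_eq_prod prod.distrib[symmetric]
  by (intro integrable_prod_coord integrable_hermite1_prod)

lemma hermite_fun_orthonormal:
  "(LINT x|lborel. hermite_fun \<alpha> x * hermite_fun \<beta> x) = (if \<alpha> = \<beta> then 1 else 0)"
  unfolding hermite_fun_eq_prod prod.distrib[symmetric]
  by (subst integral_prod_coord) (auto simp: integrable_hermite1_prod hermite1_orthonormal fun_eq_iff)

section \<open>Hermite series with summable coefficients\<close>

lemma infinite_UNIV_multi_index: "infinite (UNIV :: ('d::finite \<Rightarrow> nat) set)"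
proof
  assume "finite (UNIV :: ('d \<Rightarrow> nat) set)"
  then have "finite (range (\<lambda>n::nat. (\<lambda>_::'d. n)))" by (rule finite_subset[rotated]) simp
  then show False by (subst (asm) finite_image_iff) (auto simp: inj_on_def fun_eq_iff)
qed

text \<open>
  Orthonormality allows the series to be integrated termwise against \<open>h\<^sub>\<beta>\<close>, because
  \<open>\<bar>h\<^sub>\<alpha> h\<^sub>\<beta>\<bar> \<le> h\<^sub>\<alpha>\<^sup>2 + h\<^sub>\<beta>\<^sup>2\<close>, where the right-hand side has integral \<open>2\<close>. Square integrability follows from the weighted
  Cauchy-Schwarz inequality \<open>\<bar>f\<bar>\<^sup>2 \<le> (\<Sum>\<bar>c\<^sub>\<alpha>\<bar>) (\<Sum>\<bar>c\<^sub>\<alpha>\<bar> h\<^sub>\<alpha>\<^sup>2)\<close>, whose right-hand side has integral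
  \<open>(\<Sum>\<bar>c\<^sub>\<alpha>\<bar>)\<^sup>2\<close>.
\<close>

lemma hermite_series_synthesis:
  fixes c :: "('d::finite \<Rightarrow> nat) \<Rightarrow> complex"
  assumes c: "(\<lambda>\<alpha>. norm (c \<alpha>)) summable_on UNIV"
    and sq: "\<And>x. (\<lambda>\<alpha>. norm (c \<alpha>) * (hermite_fun \<alpha> x)\<^sup>2) summable_on UNIV"
    and f: "\<And>x. ((\<lambda>\<alpha>. c \<alpha> * complex_of_real (hermite_fun \<alpha> x)) has_sum f x) UNIV"
  shows "L2_fun f" and "hermite_coeff f = c"
proof -
  \<comment> \<open>an enumeration of the multi-indices, to use the convergence theorems for integrals of series\<close>
  define g :: "nat \<Rightarrow> 'd \<Rightarrow> nat" where "g = from_nat_into UNIV"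
  have g: "bij_betw g UNIV UNIV"
    unfolding g_def by (intro bij_betw_from_nat_into infinite_UNIV_multi_index) simp
  define a where "a n = c (g n)" for n
  define H where "H n = hermite_fun (g n)" for n
  have [measurable]: "H n \<in> borel_measurable borel" for n by (simp add: H_def)
  have sa: "summable (\<lambda>n. norm (a n))"
    using c unfolding a_def summable_on_reindex_bij_betw[OF g, symmetric] by (rule summable_on_imp_summable)
  have ssq: "summable (\<lambda>n. norm (a n) * (H n x)\<^sup>2)" for x
    using sq[of x] unfolding a_def H_def
    by (subst (asm) summable_on_reindex_bij_betw[OF g, symmetric]) (rule summable_on_imp_summable)
  have fs: "(\<lambda>n. a n * complex_of_real (H n x)) sums f x" for x
    using f[of x] unfolding a_def H_def
    by (subst (asm) has_sum_reindex_bij_betw[OF g, symmetric]) (rule has_sum_imp_sums)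
  have [measurable]: "f \<in> borel_measurable borel"
  proof (rule borel_measurable_LIMSEQ_metric)
    show "(\<lambda>n. \<Sum>i<n. a i * complex_of_real (H i x)) \<longlonglongrightarrow> f x" for x
      using fs[of x] by (simp add: sums_def)
  qed measurable
  have HH: "integrable lborel (\<lambda>x. H n x * hermite_fun \<beta> x)" "integrable lborel (\<lambda>x. (H n x)\<^sup>2)"
    "integrable lborel (\<lambda>x. (hermite_fun \<beta> x)\<^sup>2)" for n and \<beta> :: "'d \<Rightarrow> nat"
    using integrable_hermite_fun_prod[of "g n" \<beta>] integrable_hermite_fun_prod[of "g n" "g n"]
      integrable_hermite_fun_prod[of \<beta> \<beta>]
    by (simp_all add: H_def power2_eq_square)
  have H1: "(LINT x|lborel. (H n x)\<^sup>2) = 1" "(LINT x|lborel. (hermite_fun \<beta> x)\<^sup>2) = 1" for n and \<beta> :: "'d \<Rightarrow> nat"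
    using hermite_fun_orthonormal[of "g n" "g n"] hermite_fun_orthonormal[of \<beta> \<beta>]
    by (simp_all add: H_def power2_eq_square)
  define A where "A = (\<Sum>n. norm (a n))"
  define B where "B x = (\<Sum>n. norm (a n) * (H n x)\<^sup>2)" for x
  have B: "integrable lborel B"
    unfolding B_def
    by (rule integrable_suminf) (use HH H1 sa ssq in \<open>auto simp: abs_mult\<close>)
  have bound: "(cmod (f x))\<^sup>2 \<le> A * B x" for x
  proof (rule LIMSEQ_le_const2)
    show "(\<lambda>n. (cmod (\<Sum>i<n. a i * complex_of_real (H i x)))\<^sup>2) \<longlonglongrightarrow> (cmod (f x))\<^sup>2"
      using fs[of x] by (intro tendsto_intros) (simp add: sums_def)
    have "(cmod (\<Sum>i<n. a i * complex_of_real (H i x)))\<^sup>2 \<le> A * B x" for n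
    proof -
      have "cmod (\<Sum>i<n. a i * complex_of_real (H i x)) \<le> (\<Sum>i<n. norm (a i) * \<bar>H i x\<bar>)"
        by (rule order.trans[OF norm_sum]) (simp add: norm_mult)
      also have "\<dots> = (\<Sum>i<n. sqrt (norm (a i)) * (sqrt (norm (a i)) * \<bar>H i x\<bar>))"
        by (simp add: mult.assoc[symmetric])
      finally have "(cmod (\<Sum>i<n. a i * complex_of_real (H i x)))\<^sup>2 \<le>
          (\<Sum>i<n. sqrt (norm (a i)) * (sqrt (norm (a i)) * \<bar>H i x\<bar>))\<^sup>2"
        by (intro power_mono) auto
      also have "\<dots> \<le> (\<Sum>i<n. (sqrt (norm (a i)))\<^sup>2) * (\<Sum>i<n. (sqrt (norm (a i)) * \<bar>H i x\<bar>)\<^sup>2)"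
        by (rule Cauchy_Schwarz_ineq_sum)
      also have "\<dots> = (\<Sum>i<n. norm (a i)) * (\<Sum>i<n. norm (a i) * (H i x)\<^sup>2)"
        by (simp add: power_mult_distrib)
      also have "\<dots> \<le> A * B x"
        unfolding A_def B_def
        by (intro mult_mono sum_le_suminf suminf_nonneg sum_nonneg sa ssq) auto
      finally show ?thesis .
    qed
    then show "\<exists>N. \<forall>n\<ge>N. (cmod (\<Sum>i<n. a i * complex_of_real (H i x)))\<^sup>2 \<le> A * B x" by blast
  qed
  have "integrable lborel (\<lambda>x. (cmod (f x))\<^sup>2)"
  proof (rule Bochner_Integration.integrable_bound)
    show "integrable lborel (\<lambda>x. A * B x)" using B by (rule integrable_mult_right)
    show "AE x in lborel. norm ((cmod (f x))\<^sup>2) \<le> norm (A * B x)"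
      using order.trans[OF bound abs_ge_self] by (intro AE_I2) simp
  qed measurable
  then show "L2_fun f" by (simp add: L2_fun_def)

  show "hermite_coeff f = c"
  proof
    fix \<beta> :: "'d \<Rightarrow> nat"
    let ?h = "hermite_fun \<beta>"
    let ?F = "\<lambda>n x. a n * complex_of_real (H n x * ?h x)"
    have Fi: "integrable lborel (?F n)" for n
      using HH(1) by (intro integrable_mult_right) (rule integrable_of_real)
    have le: "norm (a n) * \<bar>H n x * ?h x\<bar> \<le> norm (a n) * ((H n x)\<^sup>2 + (?h x)\<^sup>2)" for n x
    proof (rule mult_left_mono)
      show "\<bar>H n x * ?h x\<bar> \<le> (H n x)\<^sup>2 + (?h x)\<^sup>2"
        using sum_squares_bound[of "\<bar>H n x\<bar>" "\<bar>?h x\<bar>"] mult_nonneg_nonneg[of "\<bar>H n x\<bar>" "\<bar>?h x\<bar>"]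
        unfolding abs_mult power2_abs by linarith
    qed simp
    have F: "(LINT x|lborel. (\<Sum>n. ?F n x)) = (\<Sum>n. LINT x|lborel. ?F n x)"
    proof (rule integral_suminf)
      have "summable (\<lambda>n. norm (a n) * ((H n x)\<^sup>2 + (?h x)\<^sup>2))" for x
        using summable_add[OF ssq[of x] summable_mult2[OF sa, of "(?h x)\<^sup>2"]] by (simp add: algebra_simps)
      then have "summable (\<lambda>n. norm (?F n x))" for x
        by (rule summable_comparison_test[rotated])
           (use le[of _ x] in \<open>auto simp: norm_mult abs_mult\<close>)
      then show "AE x in lborel. summable (\<lambda>n. norm (?F n x))" by simp
      have "norm (LINT x|lborel. norm (?F n x)) \<le> norm (a n) * 2" for n
      proof -
        have "(LINT x|lborel. norm (?F n x)) \<le> (LINT x|lborel. norm (a n) * ((H n x)\<^sup>2 + (?h x)\<^sup>2))"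
          using le[of n] HH Fi[of n] by (intro integral_mono integrable_norm) (auto simp: norm_mult abs_mult)
        also have "\<dots> = norm (a n) * 2" using HH H1 by simp
        finally show ?thesis by simp
      qed
      then show "summable (\<lambda>n. LINT x|lborel. norm (?F n x))"
        by (intro summable_comparison_test[OF _ summable_mult2[OF sa, of 2]]) auto
    qed (rule Fi)
    have "hermite_coeff f \<beta> = (LINT x|lborel. f x * complex_of_real (?h x))"
      by (simp add: hermite_coeff_def L2_inner_def)
    also have "\<dots> = (LINT x|lborel. (\<Sum>n. ?F n x))"
      using sums_unique[OF sums_mult2[OF fs]]
      by (intro Bochner_Integration.integral_cong) (simp_all add: mult.assoc)
    also have "\<dots> = (\<Sum>n. LINT x|lborel. ?F n x)" by (rule F)
    also have "\<dots> = (\<Sum>n. a n * (if g n = \<beta> then 1 else 0))"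
    proof (rule suminf_cong)
      fix n
      have "(LINT x|lborel. ?F n x) = a n * complex_of_real (LINT x|lborel. H n x * ?h x)"
        by (simp only: integral_mult_right_zero integral_complex_of_real)
      also have "\<dots> = a n * (if g n = \<beta> then 1 else 0)"
        unfolding H_def hermite_fun_orthonormal by simp
      finally show "(LINT x|lborel. ?F n x) = a n * (if g n = \<beta> then 1 else 0)" .
    qed
    also have "\<dots> = c \<beta>"
    proof -
      obtain k where k: "g k = \<beta>" using g by (metis UNIV_I bij_betw_def image_iff)
      then have "g n = \<beta> \<longleftrightarrow> n = k" for n
        using g by (metis bij_betw_def injD)
      then have "(\<lambda>n. a n * (if g n = \<beta> then 1 else 0)) = (\<lambda>n. if n = k then c \<beta> else 0)"
        by (auto simp: a_def k)
      then show ?thesis using sums_unique[OF sums_single[of k "\<lambda>_. c \<beta>"]] by simp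
    qed
    finally show "hermite_coeff f \<beta> = c \<beta>" .
  qed
qed

section \<open>Double series and pairs of multi-indices\<close>

lemma
  fixes F :: "'a \<Rightarrow> 'b \<Rightarrow> complex"
  assumes "(\<lambda>(a, b). F a b) summable_on UNIV"
  shows has_sum_iterated: "((\<lambda>a. \<Sum>\<^sub>\<infinity>b. F a b) has_sum (\<Sum>\<^sub>\<infinity>(a, b). F a b)) UNIV"
    and has_sum_iterated_swap: "((\<lambda>b. \<Sum>\<^sub>\<infinity>a. F a b) has_sum (\<Sum>\<^sub>\<infinity>(a, b). F a b)) UNIV"
proof -
  have s: "(\<lambda>(a, b). F a b) summable_on (UNIV \<times> UNIV)" using assms by simp
  show "((\<lambda>a. \<Sum>\<^sub>\<infinity>b. F a b) has_sum (\<Sum>\<^sub>\<infinity>(a, b). F a b)) UNIV"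
    using infsum_Sigma'_banach[OF s] summable_on_Sigma_banach[OF s] by (simp add: has_sum_iff)
  have s': "(\<lambda>(b, a). F a b) summable_on (UNIV \<times> UNIV)"
    using s by (subst summable_on_swap) (simp add: case_prod_unfold)
  show "((\<lambda>b. \<Sum>\<^sub>\<infinity>a. F a b) has_sum (\<Sum>\<^sub>\<infinity>(a, b). F a b)) UNIV"
    using infsum_Sigma'_banach[OF s] infsum_swap_banach[OF s] summable_on_Sigma_banach[OF s']
    by (simp add: has_sum_iff)
qed

lemma summable_on_product_complex:
  fixes f :: "'a \<Rightarrow> complex" and g :: "'b \<Rightarrow> complex"
  assumes "f summable_on UNIV" "g summable_on UNIV"
  shows "(\<lambda>(x, y). f x * g y) summable_on UNIV"
proof -
  have f: "(\<lambda>x. norm (f x)) summable_on UNIV" and g: "(\<lambda>x. norm (g x)) summable_on UNIV"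
    using assms by (simp_all add: summable_on_iff_abs_summable_on_complex)
  have "(\<lambda>p. norm (case p of (x, y) \<Rightarrow> f x * g y)) summable_on (UNIV \<times> UNIV)"
    unfolding Infinite_Sum.abs_summable_on_Sigma_iff
    using f g by (auto simp: norm_mult infsum_cmult_right' infsum_nonneg intro!: summable_on_cmult_right summable_on_cmult_left)
  then show ?thesis using abs_summable_summable by fastforce
qed

lemma has_sum_product_complex:
  fixes f :: "'a \<Rightarrow> complex" and g :: "'b \<Rightarrow> complex"
  assumes "(f has_sum a) UNIV" "(g has_sum b) UNIV"
  shows "((\<lambda>(x, y). f x * g y) has_sum (a * b)) UNIV"
proof -
  have s: "(\<lambda>(x, y). f x * g y) summable_on UNIV"
    using assms by (intro summable_on_product_complex) (auto simp: has_sum_iff)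
  have "((\<lambda>x. f x * b) has_sum (\<Sum>\<^sub>\<infinity>(x, y). f x * g y)) UNIV"
    using has_sum_iterated[OF s] assms(2) by (simp add: infsum_cmult_right' has_sum_iff)
  moreover have "((\<lambda>x. f x * b) has_sum (a * b)) UNIV"
    using assms(1) by (rule has_sum_cmult_left)
  ultimately have "(\<Sum>\<^sub>\<infinity>(x, y). f x * g y) = a * b" by (rule has_sum_unique)
  then show ?thesis using s by (simp add: has_sum_iff)
qed

text \<open>
  Sums over multi-indices of dimension \<open>d\<^sub>1 + d\<^sub>2\<close> are rewritten as double sums by this bijection.
\<close>

lemma bij_case_sum: "bij_betw (\<lambda>(\<alpha>, \<beta>). case_sum \<alpha> \<beta>) UNIV (UNIV :: ('m + 'n \<Rightarrow> 'c) set)"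
  by (rule bij_betw_byWitness[where f' = "\<lambda>\<gamma>. (\<gamma> \<circ> Inl, \<gamma> \<circ> Inr)"])
     (auto simp: fun_eq_iff split: sum.splits)

lemma has_sum_case_sum:
  "((\<lambda>(\<alpha>, \<beta>). F (case_sum \<alpha> \<beta>)) has_sum S) UNIV \<longleftrightarrow> (F has_sum S) UNIV"
  using has_sum_reindex_bij_betw[OF bij_case_sum, of F S] by (simp add: case_prod_unfold)

lemma summable_on_case_sum:
  "(\<lambda>(\<alpha>, \<beta>). F (case_sum \<alpha> \<beta>)) summable_on UNIV \<longleftrightarrow> F summable_on UNIV"
  by (simp add: summable_on_def has_sum_case_sum)

lemma infsum_case_sum: "(\<Sum>\<^sub>\<infinity>(\<alpha>, \<beta>). F (case_sum \<alpha> \<beta>)) = (\<Sum>\<^sub>\<infinity>\<gamma>. F \<gamma>)"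
  using infsum_reindex_bij_betw[OF bij_case_sum, of F] by (simp add: case_prod_unfold)

lemma case_sum_comp: "case_sum \<alpha> \<beta> \<circ> Inl = \<alpha>" "case_sum \<alpha> \<beta> \<circ> Inr = \<beta>"
  by auto

lemma case_sum_eta: "case_sum (\<gamma> \<circ> Inl) (\<gamma> \<circ> Inr) = \<gamma>"
  by (auto simp: fun_eq_iff split: sum.splits)

lemma prod_UNIV_sum:
  fixes F :: "'m::finite + 'n::finite \<Rightarrow> 'c::comm_monoid_mult"
  shows "(\<Prod>i\<in>UNIV. F i) = (\<Prod>a\<in>UNIV. F (Inl a)) * (\<Prod>b\<in>UNIV. F (Inr b))"
  by (simp add: UNIV_Plus_UNIV[symmetric] prod.Plus del: UNIV_Plus_UNIV)

lemma hermite_fun_case_sum: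
  "hermite_fun (case_sum \<alpha> \<beta>) x = hermite_fun \<alpha> (\<chi> a. x $ Inl a) * hermite_fun \<beta> (\<chi> b. x $ Inr b)"
  by (simp add: hermite_fun_eq_prod prod_UNIV_sum)

lemma hermite_fun_join: "hermite_fun (case_sum \<alpha> \<beta>) (join x y) = hermite_fun \<alpha> x * hermite_fun \<beta> y"
  by (simp add: hermite_fun_case_sum join_def)

section \<open>Polynomial growth of point evaluations\<close>

definition poly_growth :: "(('d::finite \<Rightarrow> nat) \<Rightarrow> complex) \<Rightarrow> bool" where
  "poly_growth c \<longleftrightarrow> (\<exists>C k. \<forall>\<alpha>. cmod (c \<alpha>) \<le> C * (1 + real (mlength \<alpha>)) ^ k)"

lemma poly_growth_1: "poly_growth (\<lambda>_. 1)"
  unfolding poly_growth_def by (intro exI[of _ 1] exI[of _ 0]) simp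

lemma poly_growth_mult:
  assumes "poly_growth c" "poly_growth d"
  shows "poly_growth (\<lambda>\<alpha>. c \<alpha> * d \<alpha>)"
proof -
  obtain C k C' k' where
    C: "\<And>\<alpha>. cmod (c \<alpha>) \<le> C * (1 + real (mlength \<alpha>)) ^ k"
      "\<And>\<alpha>. cmod (d \<alpha>) \<le> C' * (1 + real (mlength \<alpha>)) ^ k'"
    using assms unfolding poly_growth_def by metis
  have "cmod (c \<alpha> * d \<alpha>) \<le> (C * C') * (1 + real (mlength \<alpha>)) ^ (k + k')" for \<alpha>
  proof -
    have "cmod (c \<alpha> * d \<alpha>) \<le> (C * (1 + real (mlength \<alpha>)) ^ k) * (C' * (1 + real (mlength \<alpha>)) ^ k')"
      unfolding norm_mult by (intro mult_mono C norm_ge_zero order.trans[OF norm_ge_zero C(1)])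
    then show ?thesis by (simp add: power_add mult_ac)
  qed
  then show ?thesis unfolding poly_growth_def by blast
qed

lemma le_mlength: "\<alpha> i \<le> mlength \<alpha>"
  unfolding mlength_def by (rule member_le_sum) auto

text \<open>
  Evaluation of Hermite series at the point \<open>x\<close> is pairing with this sequence. Each of the finitely many
  one-dimensional factors grows at most linearly in its index.
\<close>

lemma poly_growth_hermite_fun: "poly_growth (\<lambda>\<alpha>. complex_of_real (hermite_fun \<alpha> x))"
proof -
  have "\<exists>C. \<forall>i. C i \<ge> 1 \<and> (\<forall>n. \<bar>hermite1 n (x $ i)\<bar> \<le> C i * (1 + real n))"
    by (intro choice allI) (metis hermite1_pointwise_bound)
  then obtain C where C: "\<And>i. C i \<ge> 1" "\<And>i n. \<bar>hermite1 n (x $ i)\<bar> \<le> C i * (1 + real n)"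
    by blast
  have "cmod (complex_of_real (hermite_fun \<alpha> x)) \<le> (\<Prod>i\<in>UNIV. C i) * (1 + real (mlength \<alpha>)) ^ CARD('a)" for \<alpha>
  proof -
    have "cmod (complex_of_real (hermite_fun \<alpha> x)) = (\<Prod>i\<in>UNIV. \<bar>hermite1 (\<alpha> i) (x $ i)\<bar>)"
      by (simp only: norm_of_real hermite_fun_eq_prod abs_prod)
    also have "\<dots> \<le> (\<Prod>i\<in>UNIV. C i * (1 + real (mlength \<alpha>)))"
    proof (intro prod_mono conjI)
      fix i
      have "\<bar>hermite1 (\<alpha> i) (x $ i)\<bar> \<le> C i * (1 + real (\<alpha> i))" by (rule C)
      also have "\<dots> \<le> C i * (1 + real (mlength \<alpha>))"
        using C(1)[of i] le_mlength[of \<alpha> i] by (intro mult_left_mono) auto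
      finally show "\<bar>hermite1 (\<alpha> i) (x $ i)\<bar> \<le> C i * (1 + real (mlength \<alpha>))" .
    qed simp
    also have "\<dots> = (\<Prod>i\<in>UNIV. C i) * (1 + real (mlength \<alpha>)) ^ CARD('a)"
      by (simp add: prod.distrib)
    finally show ?thesis .
  qed
  then show ?thesis unfolding poly_growth_def by blast
qed

section \<open>Test sequences, dual sequences and their pairing\<close>

definition hermite_space :: "(('d::finite \<Rightarrow> nat) \<Rightarrow> complex) set \<Rightarrow> (real ^ 'd \<Rightarrow> complex) set" where
  "hermite_space S =
     {\<phi>. \<exists>c\<in>S. \<forall>x. ((\<lambda>\<alpha>. c \<alpha> * complex_of_real (hermite_fun \<alpha> x)) has_sum \<phi> x) UNIV}"

text \<open>
  Test sequences \<open>S\<close> and dual sequences \<open>D\<close>. The unit sequences correspond to the Hermite functions.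
  That \<open>D\<close> contains the sequences of polynomial growth makes point evaluation and its square act on
  \<open>S\<close>, which provides the hypotheses of \<open>hermite_series_synthesis\<close>.
\<close>

locale sequence_dual_pair =
  fixes S D :: "(('d::finite \<Rightarrow> nat) \<Rightarrow> complex) set"
  assumes unit: "(\<lambda>\<alpha>. if \<alpha> = \<beta> then 1 else 0) \<in> S"
    and poly: "poly_growth f \<Longrightarrow> f \<in> D"
    and summable: "c \<in> S \<Longrightarrow> f \<in> D \<Longrightarrow> (\<lambda>\<alpha>. f \<alpha> * c \<alpha>) summable_on UNIV"
begin

lemma
  assumes c: "c \<in> S"
    and \<phi>: "\<And>x. ((\<lambda>\<alpha>. c \<alpha> * complex_of_real (hermite_fun \<alpha> x)) has_sum \<phi> x) UNIV"
  shows hermite_coeff_series: "hermite_coeff \<phi> = c"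
    and L2_fun_series: "L2_fun \<phi>"
proof -
  have 1: "(\<lambda>\<alpha>. norm (c \<alpha>)) summable_on UNIV"
    using summable[OF c poly[OF poly_growth_1]] by (simp add: summable_on_iff_abs_summable_on_complex)
  have 2: "(\<lambda>\<alpha>. norm (c \<alpha>) * (hermite_fun \<alpha> x)\<^sup>2) summable_on UNIV" for x
    using summable[OF c poly[OF poly_growth_mult[OF poly_growth_hermite_fun[of x] poly_growth_hermite_fun[of x]]]]
    by (subst (asm) summable_on_iff_abs_summable_on_complex)
       (simp add: norm_mult abs_mult[symmetric] power2_eq_square mult_ac)
  show "hermite_coeff \<phi> = c" "L2_fun \<phi>"
    using hermite_series_synthesis[OF 1 2 \<phi>] by blast+
qed

lemma hermite_spaceI:
  assumes "c \<in> S" "\<And>x. ((\<lambda>\<alpha>. c \<alpha> * complex_of_real (hermite_fun \<alpha> x)) has_sum \<phi> x) UNIV"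
  shows "\<phi> \<in> hermite_space S"
  using assms by (auto simp: hermite_space_def)

lemma
  assumes "\<phi> \<in> hermite_space S"
  shows hermite_coeff_in: "hermite_coeff \<phi> \<in> S"
    and hermite_space_has_sum: "((\<lambda>\<alpha>. hermite_coeff \<phi> \<alpha> * complex_of_real (hermite_fun \<alpha> x)) has_sum \<phi> x) UNIV"
    and hermite_space_L2: "L2_fun \<phi>"
  using assms hermite_coeff_series L2_fun_series by (auto simp: hermite_space_def)

text \<open>
  The spaces of functions are defined by conditions on their coefficients and a pointwise series
  representation; this identifies them with the synthesised spaces.
\<close>

lemma hermite_space_eq:
  "hermite_space S = {\<phi>. L2_fun \<phi> \<and> hermite_series_rep \<phi> \<and> hermite_coeff \<phi> \<in> S}"
  using hermite_coeff_in hermite_space_has_sum hermite_space_L2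
  by (auto simp: hermite_series_rep_def intro!: hermite_spaceI)

lemma hermite_fun_in_space: "(\<lambda>x. complex_of_real (hermite_fun \<alpha> x)) \<in> hermite_space S"
  and hermite_coeff_hermite_fun:
    "hermite_coeff (\<lambda>x. complex_of_real (hermite_fun \<alpha> x)) = (\<lambda>\<beta>. if \<beta> = \<alpha> then 1 else 0)"
proof -
  have "((\<lambda>\<beta>. (if \<beta> = \<alpha> then 1 else 0) * complex_of_real (hermite_fun \<beta> x)) has_sum complex_of_real (hermite_fun \<alpha> x)) UNIV" for x
    by (rule has_sum_finite_neutralI[of "{\<alpha>}"]) auto
  note * = unit[of \<alpha>] this
  show "(\<lambda>x. complex_of_real (hermite_fun \<alpha> x)) \<in> hermite_space S"
    using * by (rule hermite_spaceI)
  show "hermite_coeff (\<lambda>x. complex_of_real (hermite_fun \<alpha> x)) = (\<lambda>\<beta>. if \<beta> = \<alpha> then 1 else 0)"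
    using * by (rule hermite_coeff_series)
qed

lemma pairing_has_sum:
  assumes "\<phi> \<in> hermite_space S" "f \<in> D"
  shows "((\<lambda>\<alpha>. f \<alpha> * hermite_coeff \<phi> \<alpha>) has_sum pairing f \<phi>) UNIV"
  using summable[OF hermite_coeff_in[OF assms(1)] assms(2)] by (simp add: pairing_def)

end

text \<open>
  The heart of the matter. For fixed \<open>x\<close>, the function \<open>\<Phi> x\<close> has the coefficients
  \<open>d(\<beta>) = \<Sum>\<^sub>\<alpha> h\<^sub>\<alpha>(x) k(\<alpha>, \<beta>)\<close>, a contraction of \<open>k\<close> with the dual sequence of point evaluation. Pairing
  with \<open>f\<^sub>2\<close> and exchanging the two sums exhibits \<open>\<psi>\<close> as the Hermite series with coefficients
  \<open>e(\<alpha>) = \<Sum>\<^sub>\<beta> f\<^sub>2(\<beta>) k(\<alpha>, \<beta>)\<close>, and pairing this with \<open>f\<^sub>1\<close> gives the full double series.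

  The kernel \<open>k\<close> is kept as a function of two multi-indices so that the lemma can be applied to
  either variable.
\<close>

lemma partial_pairing:
  fixes S1 D1 :: "(('m::finite \<Rightarrow> nat) \<Rightarrow> complex) set" and S2 D2 :: "(('n::finite \<Rightarrow> nat) \<Rightarrow> complex) set"
    and k :: "('m \<Rightarrow> nat) \<Rightarrow> ('n \<Rightarrow> nat) \<Rightarrow> complex"
  assumes P1: "sequence_dual_pair S1 D1" and P2: "sequence_dual_pair S2 D2"
    and \<Phi>: "\<And>x y. ((\<lambda>(\<alpha>, \<beta>). k \<alpha> \<beta> * complex_of_real (hermite_fun \<alpha> x * hermite_fun \<beta> y)) has_sum \<Phi> x y) UNIV"
    and row: "\<And>f. f \<in> D2 \<Longrightarrow> (\<lambda>\<alpha>. \<Sum>\<^sub>\<infinity>\<beta>. f \<beta> * k \<alpha> \<beta>) \<in> S1"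
    and col: "\<And>f. f \<in> D1 \<Longrightarrow> (\<lambda>\<beta>. \<Sum>\<^sub>\<infinity>\<alpha>. f \<alpha> * k \<alpha> \<beta>) \<in> S2"
    and joint: "\<And>f g. f \<in> D1 \<Longrightarrow> g \<in> D2 \<Longrightarrow> (\<lambda>(\<alpha>, \<beta>). f \<alpha> * g \<beta> * k \<alpha> \<beta>) summable_on UNIV"
    and f2: "f2 \<in> D2"
    and \<psi>: "\<And>x. \<psi> x = pairing f2 (\<Phi> x)"
  shows partial_pairing_in_space: "\<psi> \<in> hermite_space S1"
    and pairing_partial_pairing:
      "f1 \<in> D1 \<Longrightarrow> pairing f1 \<psi> = (\<Sum>\<^sub>\<infinity>(\<alpha>, \<beta>). f1 \<alpha> * f2 \<beta> * k \<alpha> \<beta>)"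
proof -
  interpret P1: sequence_dual_pair S1 D1 by (rule P1)
  interpret P2: sequence_dual_pair S2 D2 by (rule P2)
  define e where "e \<alpha> = (\<Sum>\<^sub>\<infinity>\<beta>. f2 \<beta> * k \<alpha> \<beta>)" for \<alpha>
  have e: "e \<in> S1" unfolding e_def using row[OF f2] .
  have series: "((\<lambda>\<alpha>. e \<alpha> * complex_of_real (hermite_fun \<alpha> x)) has_sum \<psi> x) UNIV" for x
  proof -
    \<comment> \<open>the dual sequence that evaluates Hermite series at \<open>x\<close>\<close>
    define u where "u \<alpha> = complex_of_real (hermite_fun \<alpha> x)" for \<alpha> :: "'m \<Rightarrow> nat"
    have u: "u \<in> D1" unfolding u_def by (intro P1.poly poly_growth_hermite_fun)
    define d where "d \<beta> = (\<Sum>\<^sub>\<infinity>\<alpha>. u \<alpha> * k \<alpha> \<beta>)" for \<beta>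
    have "((\<lambda>\<beta>. d \<beta> * complex_of_real (hermite_fun \<beta> y)) has_sum \<Phi> x y) UNIV" for y
    proof -
      have s: "(\<lambda>(\<alpha>, \<beta>). u \<alpha> * complex_of_real (hermite_fun \<beta> y) * k \<alpha> \<beta>) summable_on UNIV"
        by (intro joint u P2.poly poly_growth_hermite_fun)
      have "(\<Sum>\<^sub>\<infinity>(\<alpha>, \<beta>). u \<alpha> * complex_of_real (hermite_fun \<beta> y) * k \<alpha> \<beta>) = \<Phi> x y"
        using \<Phi>[of x y] by (simp add: has_sum_iff u_def mult_ac)
      moreover have "(\<Sum>\<^sub>\<infinity>\<alpha>. u \<alpha> * complex_of_real (hermite_fun \<beta> y) * k \<alpha> \<beta>)
          = d \<beta> * complex_of_real (hermite_fun \<beta> y)" for \<beta>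
        unfolding d_def infsum_cmult_left'[symmetric] by (simp add: mult_ac)
      ultimately show ?thesis using has_sum_iterated_swap[OF s] by simp
    qed
    moreover have "d \<in> S2" unfolding d_def by (rule col[OF u])
    ultimately have "hermite_coeff (\<Phi> x) = d" by (rule P2.hermite_coeff_series[rotated])
    then have "\<psi> x = (\<Sum>\<^sub>\<infinity>\<beta>. f2 \<beta> * d \<beta>)" by (simp add: \<psi> pairing_def)
    also have "\<dots> = (\<Sum>\<^sub>\<infinity>\<beta>. \<Sum>\<^sub>\<infinity>\<alpha>. u \<alpha> * f2 \<beta> * k \<alpha> \<beta>)"
      unfolding d_def infsum_cmult_right'[symmetric] by (simp add: mult_ac)
    also have "\<dots> = (\<Sum>\<^sub>\<infinity>(\<alpha>, \<beta>). u \<alpha> * f2 \<beta> * k \<alpha> \<beta>)"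
      using has_sum_iterated_swap[OF joint[OF u f2]] by (simp add: has_sum_iff)
    finally have "((\<lambda>\<alpha>. \<Sum>\<^sub>\<infinity>\<beta>. u \<alpha> * f2 \<beta> * k \<alpha> \<beta>) has_sum \<psi> x) UNIV"
      using has_sum_iterated[OF joint[OF u f2]] by simp
    moreover have "(\<Sum>\<^sub>\<infinity>\<beta>. u \<alpha> * f2 \<beta> * k \<alpha> \<beta>) = e \<alpha> * complex_of_real (hermite_fun \<alpha> x)" for \<alpha>
      unfolding e_def infsum_cmult_left'[symmetric] by (simp add: mult_ac u_def)
    ultimately show ?thesis by simp
  qed
  show "\<psi> \<in> hermite_space S1" using e series by (rule P1.hermite_spaceI)
  assume f1: "f1 \<in> D1"
  have "hermite_coeff \<psi> = e" using e series by (rule P1.hermite_coeff_series)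
  then have "pairing f1 \<psi> = (\<Sum>\<^sub>\<infinity>\<alpha>. f1 \<alpha> * e \<alpha>)" by (simp add: pairing_def)
  also have "\<dots> = (\<Sum>\<^sub>\<infinity>\<alpha>. \<Sum>\<^sub>\<infinity>\<beta>. f1 \<alpha> * f2 \<beta> * k \<alpha> \<beta>)"
    unfolding e_def infsum_cmult_right'[symmetric] by (simp add: mult_ac)
  also have "\<dots> = (\<Sum>\<^sub>\<infinity>(\<alpha>, \<beta>). f1 \<alpha> * f2 \<beta> * k \<alpha> \<beta>)"
    using has_sum_iterated[OF joint[OF f1 f2]] by (simp add: has_sum_iff)
  finally show "pairing f1 \<psi> = (\<Sum>\<^sub>\<infinity>(\<alpha>, \<beta>). f1 \<alpha> * f2 \<beta> * k \<alpha> \<beta>)" .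
qed

text \<open>
  Multiplying the two Hermite series gives an absolutely convergent double series for the tensor
  product, from which its coefficients are read off.
\<close>

lemma hermite_coeff_tensor:
  fixes S1 D1 :: "(('m::finite \<Rightarrow> nat) \<Rightarrow> complex) set" and S2 D2 :: "(('n::finite \<Rightarrow> nat) \<Rightarrow> complex) set"
  assumes P1: "sequence_dual_pair S1 D1" and P2: "sequence_dual_pair S2 D2"
    and \<phi>1: "\<phi>1 \<in> hermite_space S1" and \<phi>2: "\<phi>2 \<in> hermite_space S2"
  shows "hermite_coeff (tensor \<phi>1 \<phi>2) (case_sum \<alpha> \<beta>) = hermite_coeff \<phi>1 \<alpha> * hermite_coeff \<phi>2 \<beta>"
proof -
  interpret P1: sequence_dual_pair S1 D1 by (rule P1)
  interpret P2: sequence_dual_pair S2 D2 by (rule P2)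
  define c where "c \<gamma> = hermite_coeff \<phi>1 (\<gamma> \<circ> Inl) * hermite_coeff \<phi>2 (\<gamma> \<circ> Inr)" for \<gamma> :: "'m + 'n \<Rightarrow> nat"
  have weighted: "(\<lambda>\<gamma>. f (\<gamma> \<circ> Inl) * g (\<gamma> \<circ> Inr) * c \<gamma>) summable_on UNIV"
    if f: "poly_growth f" and g: "poly_growth g" for f g
  proof -
    have "(\<lambda>(\<alpha>, \<beta>). (f \<alpha> * hermite_coeff \<phi>1 \<alpha>) * (g \<beta> * hermite_coeff \<phi>2 \<beta>)) summable_on UNIV"
      using P1.summable[OF P1.hermite_coeff_in[OF \<phi>1] P1.poly[OF f]]
        P2.summable[OF P2.hermite_coeff_in[OF \<phi>2] P2.poly[OF g]]
      by (rule summable_on_product_complex)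
    then show ?thesis
      unfolding summable_on_case_sum[symmetric] case_sum_comp c_def by (simp add: mult_ac)
  qed
  have "hermite_coeff (tensor \<phi>1 \<phi>2) = c"
  proof (rule hermite_series_synthesis(2))
    show "(\<lambda>\<gamma>. norm (c \<gamma>)) summable_on UNIV"
      using weighted[OF poly_growth_1 poly_growth_1] by (simp add: summable_on_iff_abs_summable_on_complex)
    fix x :: "real ^ ('m + 'n)"
    let ?x = "\<chi> a. x $ Inl a" and ?y = "\<chi> b. x $ Inr b"
    have h: "hermite_fun \<gamma> x = hermite_fun (\<gamma> \<circ> Inl) ?x * hermite_fun (\<gamma> \<circ> Inr) ?y" for \<gamma> :: "'m + 'n \<Rightarrow> nat"
      using hermite_fun_case_sum[of "\<gamma> \<circ> Inl" "\<gamma> \<circ> Inr" x] by (simp only: case_sum_eta)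
    show "(\<lambda>\<gamma>. norm (c \<gamma>) * (hermite_fun \<gamma> x)\<^sup>2) summable_on UNIV"
      using weighted[OF poly_growth_mult[OF poly_growth_hermite_fun[of ?x] poly_growth_hermite_fun[of ?x]]
          poly_growth_mult[OF poly_growth_hermite_fun[of ?y] poly_growth_hermite_fun[of ?y]]]
      by (subst (asm) summable_on_iff_abs_summable_on_complex)
         (simp add: norm_mult h abs_mult[symmetric] power2_eq_square mult_ac)
    show "((\<lambda>\<gamma>. c \<gamma> * complex_of_real (hermite_fun \<gamma> x)) has_sum tensor \<phi>1 \<phi>2 x) UNIV"
      unfolding has_sum_case_sum[symmetric] tensor_def c_def hermite_fun_case_sum case_sum_comp
      using has_sum_product_complex[OF P1.hermite_space_has_sum[OF \<phi>1, of ?x] P2.hermite_space_has_sum[OF \<phi>2, of ?y]]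
      by (simp add: mult_ac)
  qed
  then show ?thesis by (simp add: c_def case_sum_comp)
qed

text \<open>
  Three dual pairs, in dimensions \<open>d\<^sub>1\<close>, \<open>d\<^sub>2\<close> and \<open>d\<^sub>1 + d\<^sub>2\<close>, that are compatible with tensor products
  of dual sequences and with contractions of test sequences.
\<close>

locale tensor_dual_pairs =
  P1: sequence_dual_pair S1 D1 + P2: sequence_dual_pair S2 D2 + P: sequence_dual_pair S D
  for S1 D1 :: "(('m::finite \<Rightarrow> nat) \<Rightarrow> complex) set"
    and S2 D2 :: "(('n::finite \<Rightarrow> nat) \<Rightarrow> complex) set"
    and S D :: "(('m + 'n \<Rightarrow> nat) \<Rightarrow> complex) set" +
  assumes contract_right: "c \<in> S \<Longrightarrow> f \<in> D2 \<Longrightarrow> (\<lambda>\<alpha>. \<Sum>\<^sub>\<infinity>\<beta>. f \<beta> * c (case_sum \<alpha> \<beta>)) \<in> S1"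
    and contract_left: "c \<in> S \<Longrightarrow> g \<in> D1 \<Longrightarrow> (\<lambda>\<beta>. \<Sum>\<^sub>\<infinity>\<alpha>. g \<alpha> * c (case_sum \<alpha> \<beta>)) \<in> S2"
    and tensor_in: "f1 \<in> D1 \<Longrightarrow> f2 \<in> D2 \<Longrightarrow> (\<lambda>\<gamma>. f1 (\<gamma> \<circ> Inl) * f2 (\<gamma> \<circ> Inr)) \<in> D"
begin

theorem tensor_product_of_functionals:
  assumes f1: "f1 \<in> D1" and f2: "f2 \<in> D2" and \<phi>: "\<phi> \<in> hermite_space S"
    and psi1: "\<And>x1. \<psi>1 x1 = pairing f2 (\<lambda>x2. \<phi> (join x1 x2))"
    and psi2: "\<And>x2. \<psi>2 x2 = pairing f1 (\<lambda>x1. \<phi> (join x1 x2))"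
  shows "\<psi>1 \<in> hermite_space S1 \<and> \<psi>2 \<in> hermite_space S2 \<and>
    (\<exists>!f. f \<in> D \<and>
       (\<forall>\<phi>1 \<in> hermite_space S1. \<forall>\<phi>2 \<in> hermite_space S2.
          pairing f (tensor \<phi>1 \<phi>2) = pairing f1 \<phi>1 * pairing f2 \<phi>2) \<and>
       pairing f \<phi> = pairing f1 \<psi>1 \<and> pairing f1 \<psi>1 = pairing f2 \<psi>2)"
proof (intro conjI)
  define c where "c = hermite_coeff \<phi>"
  have c: "c \<in> S" unfolding c_def by (rule P.hermite_coeff_in[OF \<phi>])
  define t :: "('m + 'n \<Rightarrow> nat) \<Rightarrow> complex" where "t = (\<lambda>\<gamma>. f1 (\<gamma> \<circ> Inl) * f2 (\<gamma> \<circ> Inr))"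
  have joint: "(\<lambda>(\<alpha>, \<beta>). f \<alpha> * g \<beta> * c (case_sum \<alpha> \<beta>)) summable_on UNIV"
    if "f \<in> D1" "g \<in> D2" for f g
    using P.summable[OF c tensor_in[OF that]]
    unfolding summable_on_case_sum[symmetric] case_sum_comp .
  have ser: "((\<lambda>(\<alpha>, \<beta>). c (case_sum \<alpha> \<beta>) * complex_of_real (hermite_fun \<alpha> x * hermite_fun \<beta> y))
      has_sum \<phi> (join x y)) UNIV" for x y
    using P.hermite_space_has_sum[OF \<phi>, of "join x y"]
    unfolding has_sum_case_sum[symmetric] hermite_fun_join c_def .
  have ser': "((\<lambda>(\<beta>, \<alpha>). c (case_sum \<alpha> \<beta>) * complex_of_real (hermite_fun \<beta> y * hermite_fun \<alpha> x))
      has_sum \<phi> (join x y)) UNIV" for x y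
    using ser[of x y] has_sum_swap[where A = UNIV and B = UNIV and f = "\<lambda>(\<alpha>, \<beta>). c (case_sum \<alpha> \<beta>) * complex_of_real (hermite_fun \<alpha> x * hermite_fun \<beta> y)"]
    by (simp add: mult.commute)
  have joint': "(\<lambda>(\<beta>, \<alpha>). g \<beta> * f \<alpha> * c (case_sum \<alpha> \<beta>)) summable_on UNIV"
    if "g \<in> D2" "f \<in> D1" for f g
    using joint[OF that(2,1)] summable_on_swap[where A = UNIV and B = UNIV and f = "\<lambda>(\<alpha>, \<beta>). f \<alpha> * g \<beta> * c (case_sum \<alpha> \<beta>)"]
    by (simp add: mult.commute)
  note 1 = P1.sequence_dual_pair_axioms and 2 = P2.sequence_dual_pair_axioms
  note pp1 = partial_pairing[OF 1 2 ser contract_right[OF c] contract_left[OF c] joint f2 psi1]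
  note pp2 = partial_pairing[OF 2 1 ser' contract_left[OF c] contract_right[OF c] joint' f1 psi2]
  show "\<psi>1 \<in> hermite_space S1" by (rule pp1)
  show "\<psi>2 \<in> hermite_space S2" by (rule pp2)
  have full: "pairing t \<phi> = (\<Sum>\<^sub>\<infinity>(\<alpha>, \<beta>). f1 \<alpha> * f2 \<beta> * c (case_sum \<alpha> \<beta>))"
    unfolding pairing_def c_def[symmetric] infsum_case_sum[symmetric] by (simp add: t_def case_sum_comp)
  have e1: "pairing f1 \<psi>1 = (\<Sum>\<^sub>\<infinity>(\<alpha>, \<beta>). f1 \<alpha> * f2 \<beta> * c (case_sum \<alpha> \<beta>))"
    by (rule pp1(2)) (assumption | rule f1)+
  have "pairing f2 \<psi>2 = (\<Sum>\<^sub>\<infinity>(\<beta>, \<alpha>). f2 \<beta> * f1 \<alpha> * c (case_sum \<alpha> \<beta>))"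
    by (rule pp2(2)) (assumption | rule f2)+
  also have "\<dots> = (\<Sum>\<^sub>\<infinity>(\<alpha>, \<beta>). f1 \<alpha> * f2 \<beta> * c (case_sum \<alpha> \<beta>))"
    by (rule infsum_reindex_bij_witness[of _ prod.swap prod.swap]) (auto simp: mult.commute)
  finally have e2: "pairing f2 \<psi>2 = (\<Sum>\<^sub>\<infinity>(\<alpha>, \<beta>). f1 \<alpha> * f2 \<beta> * c (case_sum \<alpha> \<beta>))" .
  have tens: "pairing f (tensor \<phi>1 \<phi>2) = (\<Sum>\<^sub>\<infinity>(\<alpha>, \<beta>). f (case_sum \<alpha> \<beta>) * (hermite_coeff \<phi>1 \<alpha> * hermite_coeff \<phi>2 \<beta>))"
    if "\<phi>1 \<in> hermite_space S1" "\<phi>2 \<in> hermite_space S2" for f \<phi>1 \<phi>2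
    unfolding pairing_def infsum_case_sum[symmetric] hermite_coeff_tensor[OF 1 2 that] ..
  show "\<exists>!f. f \<in> D \<and>
       (\<forall>\<phi>1 \<in> hermite_space S1. \<forall>\<phi>2 \<in> hermite_space S2.
          pairing f (tensor \<phi>1 \<phi>2) = pairing f1 \<phi>1 * pairing f2 \<phi>2) \<and>
       pairing f \<phi> = pairing f1 \<psi>1 \<and> pairing f1 \<psi>1 = pairing f2 \<psi>2"
  proof (rule ex1I[of _ "t"], intro conjI ballI)
    show "t \<in> D" unfolding t_def by (rule tensor_in[OF f1 f2])
    show "pairing t \<phi> = pairing f1 \<psi>1" "pairing f1 \<psi>1 = pairing f2 \<psi>2"
      by (simp_all add: full e1 e2)
    fix \<phi>1 \<phi>2 assume \<phi>12: "\<phi>1 \<in> hermite_space S1" "\<phi>2 \<in> hermite_space S2"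
    have "((\<lambda>(\<alpha>, \<beta>). (f1 \<alpha> * hermite_coeff \<phi>1 \<alpha>) * (f2 \<beta> * hermite_coeff \<phi>2 \<beta>)) has_sum
       (pairing f1 \<phi>1 * pairing f2 \<phi>2)) UNIV"
      using P1.pairing_has_sum[OF \<phi>12(1) f1] P2.pairing_has_sum[OF \<phi>12(2) f2]
      by (rule has_sum_product_complex)
    then show "pairing t (tensor \<phi>1 \<phi>2) = pairing f1 \<phi>1 * pairing f2 \<phi>2"
      unfolding tens[OF \<phi>12] by (simp add: has_sum_iff t_def case_sum_comp mult_ac)
  next
    fix f
    assume f: "f \<in> D \<and>
       (\<forall>\<phi>1 \<in> hermite_space S1. \<forall>\<phi>2 \<in> hermite_space S2.
          pairing f (tensor \<phi>1 \<phi>2) = pairing f1 \<phi>1 * pairing f2 \<phi>2) \<and>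
       pairing f \<phi> = pairing f1 \<psi>1 \<and> pairing f1 \<psi>1 = pairing f2 \<psi>2"
    have eval: "(\<Sum>\<^sub>\<infinity>\<alpha>'. g \<alpha>' * (if \<alpha>' = \<alpha> then 1 else 0)) = g \<alpha>" for g :: "'x \<Rightarrow> complex" and \<alpha>
      by (rule infsumI) (rule has_sum_finite_neutralI[of "{\<alpha>}"], auto)
    have "f (case_sum \<alpha> \<beta>) = f1 \<alpha> * f2 \<beta>" for \<alpha> \<beta>
    proof -
      let ?\<phi>1 = "\<lambda>x. complex_of_real (hermite_fun \<alpha> x)" and ?\<phi>2 = "\<lambda>x. complex_of_real (hermite_fun \<beta> x)"
      \<comment> \<open>the coefficients of \<open>h\<^sub>\<alpha> \<otimes> h\<^sub>\<beta>\<close> form a unit sequence\<close>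
      have "f (case_sum \<alpha> \<beta>) = pairing f (tensor ?\<phi>1 ?\<phi>2)"
        unfolding tens[OF P1.hermite_fun_in_space P2.hermite_fun_in_space]
          P1.hermite_coeff_hermite_fun P2.hermite_coeff_hermite_fun
        by (rule infsumI[symmetric]) (rule has_sum_finite_neutralI[of "{(\<alpha>, \<beta>)}"], auto split: if_splits)
      also have "\<dots> = pairing f1 ?\<phi>1 * pairing f2 ?\<phi>2"
        using f P1.hermite_fun_in_space P2.hermite_fun_in_space by blast
      also have "\<dots> = f1 \<alpha> * f2 \<beta>"
        by (simp add: pairing_def P1.hermite_coeff_hermite_fun P2.hermite_coeff_hermite_fun eval del: mult_if_delta)
      finally show ?thesis .
    qed
    then have "f (case_sum (\<gamma> \<circ> Inl) (\<gamma> \<circ> Inr)) = t \<gamma>" for \<gamma>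
      unfolding t_def by blast
    then show "f = t" unfolding case_sum_eta by (rule ext)
  qed
qed

end

section \<open>Growth of the dual weights\<close>

text \<open>
  From \<open>exp(y) = exp(y / m)\<^sup>m \<ge> (y / m)\<^sup>m\<close> with \<open>m\<close> so large that \<open>p m \<ge> k\<close>.
\<close>

lemma exp_powr_dominates_power:
  fixes r p :: real
  assumes r: "r > 0" and p: "p > 0"
  obtains C where "C > 0" "\<And>n::nat. (1 + real n) ^ k \<le> C * exp (r * real n powr p)"
proof -
  obtain m0 :: nat where m0: "real m0 \<ge> real k / p" using real_arch_simple by blast
  define m where "m = Suc m0"
  have m: "p * real m \<ge> real k" "m > 0"
    using m0 p by (auto simp: m_def field_simps)
  \<comment> \<open>the summand \<open>1\<close> covers \<open>n = 0\<close>\<close>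
  define C where "C = 1 + 2 ^ k / (r / real m) ^ m"
  have C: "C \<ge> 1" using r by (simp add: C_def)
  have "(1 + real n) ^ k \<le> C * exp (r * real n powr p)" for n
  proof (cases "n = 0")
    case True
    then show ?thesis using C by simp
  next
    case False
    then have n: "real n \<ge> 1" by simp
    have "(1 + real n) ^ k \<le> (2 * real n) ^ k"
      using n by (intro power_mono) auto
    also have "\<dots> = 2 ^ k * real n powr real k"
      using n by (simp add: power_mult_distrib powr_realpow)
    also have "\<dots> \<le> 2 ^ k * real n powr (p * real m)"
      using n m by (intro mult_left_mono powr_mono) auto
    also have "\<dots> = 2 ^ k / (r / real m) ^ m * ((r / real m) * real n powr p) ^ m"
    proof -
      have y: "(real n powr p) ^ m = real n powr (p * real m)"
        using n by (simp add: powr_realpow[symmetric] powr_powr)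
      have nz: "(r / real m) ^ m \<noteq> 0" using r m by simp
      have "b * y = b / a * (a * y)" if "a \<noteq> 0" for a b y :: real
        using that by simp
      from this[OF nz] show ?thesis unfolding power_mult_distrib y .
    qed
    also have "\<dots> \<le> 2 ^ k / (r / real m) ^ m * exp (r * real n powr p)"
    proof (rule mult_left_mono)
      have "((r / real m) * real n powr p) ^ m \<le> exp ((r / real m) * real n powr p) ^ m"
      proof (rule power_mono)
        show "(r / real m) * real n powr p \<le> exp ((r / real m) * real n powr p)"
          using exp_ge_add_one_self[of "(r / real m) * real n powr p"] by linarith
      qed (use r in auto)
      also have "\<dots> = exp (r * real n powr p)"
        using m by (simp add: exp_of_nat_mult[symmetric])
      finally show "((r / real m) * real n powr p) ^ m \<le> exp (r * real n powr p)" .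
    qed (use r in auto)
    also have "\<dots> \<le> C * exp (r * real n powr p)"
      by (intro mult_right_mono) (auto simp: C_def)
    finally show ?thesis .
  qed
  then show ?thesis using that[of C] C by simp
qed

lemma two_power_dominates_power:
  obtains C where "C > 0" "\<And>n::nat. (1 + real n) ^ k \<le> C * 2 ^ n"
proof -
  obtain C where C: "C > 0" "\<And>n::nat. (1 + real n) ^ k \<le> C * exp (ln 2 * real n powr 1)"
    using exp_powr_dominates_power[of "ln 2" 1 k] by auto
  have "exp (ln 2 * real n powr 1) = 2 ^ n" for n :: nat
    by (simp add: exp_of_nat2_mult)
  then show ?thesis using C that by auto
qed

lemma power_le_exp_fact: "x ^ n \<le> exp x * fact n" if "x \<ge> 0" for x :: real
proof -
  have "(\<Sum>k\<in>{n}. inverse (fact k) * x ^ k) \<le> (\<Sum>k. inverse (fact k) * x ^ k)"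
    using that by (intro sum_le_suminf summable_exp) auto
  then have "inverse (fact n) * x ^ n \<le> exp x" by (simp add: exp_def)
  then show ?thesis by (simp add: field_simps)
qed

text \<open>
  Factorials beat exponentials: with \<open>X\<^sup>q = 2 / r\<close>, the inequality \<open>X\<^sup>n \<le> exp(X) n!\<close> raised to the power
  \<open>q\<close> shows that \<open>r\<^sup>n n!\<^sup>q\<close> is at least a constant times \<open>2\<^sup>n\<close>.
\<close>

lemma fact_powr_dominates_power:
  fixes r q :: real
  assumes r: "r > 0" and q: "q > 0"
  obtains C where "C > 0" "\<And>n::nat. (1 + real n) ^ k \<le> C * (r ^ n * fact n powr q)"
proof -
  obtain C where C: "C > 0" "\<And>n::nat. (1 + real n) ^ k \<le> C * 2 ^ n"
    using two_power_dominates_power by blast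
  \<comment> \<open>chosen such that \<open>X powr q = 2 / r\<close>, which cancels the factor \<open>r ^ n\<close> and leaves \<open>2 ^ n\<close>\<close>
  define X where "X = (2 / r) powr (1 / q)"
  have X: "X > 0" "X powr q = 2 / r" using r q by (auto simp: X_def powr_powr)
  have "(1 + real n) ^ k \<le> (C * exp X powr q) * (r ^ n * fact n powr q)" for n
  proof -
    have "(2 / r) ^ n = (X ^ n) powr q"
      using X r by (simp add: powr_realpow[symmetric] powr_powr mult.commute flip: X(2))
    also have "\<dots> \<le> (exp X * fact n) powr q"
      using X q by (intro powr_mono2 power_le_exp_fact) auto
    also have "\<dots> = exp X powr q * fact n powr q" by (simp add: powr_mult)
    finally have "r ^ n * (2 / r) ^ n \<le> r ^ n * (exp X powr q * fact n powr q)"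
      using r by (intro mult_left_mono) auto
    then have "2 ^ n \<le> r ^ n * (exp X powr q * fact n powr q)"
      using r by (simp add: power_mult_distrib[symmetric])
    then have "C * 2 ^ n \<le> C * (r ^ n * (exp X powr q * fact n powr q))"
      using C by (intro mult_left_mono) auto
    then show ?thesis using C(2)[of n] by (simp add: mult_ac)
  qed
  then show ?thesis using that[of "C * exp X powr q"] C by simp
qed

lemma weight_pos: "r > 0 \<Longrightarrow> weight r s \<alpha> > 0"
  by (cases s) (auto simp: mfact_def powr_gt_zero prod_pos)

lemma weight'_pos: "r > 0 \<Longrightarrow> weight' r s \<alpha> > 0"
  by (cases s) (auto simp: mfact_def powr_gt_zero prod_pos)

lemma one_plus_sum_le_prod:
  fixes a :: "'a \<Rightarrow> real"
  assumes "finite A" "\<And>i. i \<in> A \<Longrightarrow> a i \<ge> 0"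
  shows "1 + sum a A \<le> (\<Prod>i\<in>A. 1 + a i)"
  using assms
proof (induction A rule: finite_induct)
  case (insert i A)
  have "1 + sum a (insert i A) \<le> (1 + a i) * (1 + sum a A)"
    using insert by (simp add: algebra_simps sum_nonneg)
  also have "\<dots> \<le> (1 + a i) * (\<Prod>i\<in>A. 1 + a i)"
    using insert by (intro mult_left_mono) auto
  finally show ?case using insert by simp
qed simp

lemma R_flat_cases:
  assumes "s \<in> R_flat"
  obtains \<sigma> where "s = Ord \<sigma>" "\<sigma> > 0" | \<sigma> where "s = Flat \<sigma>" "\<sigma> > 0"
  using assms by (auto simp: R_flat_def)

text \<open>
  For \<open>s = \<flat>\<^sub>\<sigma>\<close> the dual weight is a product over the coordinates, and
  \<open>1 + \<bar>\<alpha>\<bar> \<le> \<Prod>(1 + \<alpha>\<^sub>i)\<close> reduces the claim to one dimension.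
\<close>

lemma weight'_dominates_power:
  assumes s: "s \<in> R_flat" and r: "r > 0"
  obtains C where "C > 0" "\<And>\<alpha> :: 'd::finite \<Rightarrow> nat. (1 + real (mlength \<alpha>)) ^ k \<le> C * weight' r s \<alpha>"
  using s
proof (cases rule: R_flat_cases)
  case (1 \<sigma>)
  then have p: "1 / (2 * \<sigma>) > 0" by simp
  obtain C where C: "C > 0" "\<And>n::nat. (1 + real n) ^ k \<le> C * exp (r * real n powr (1 / (2 * \<sigma>)))"
    using exp_powr_dominates_power[OF r p, of k] by blast
  show ?thesis by (rule that[OF C(1)]) (simp only: 1 weight'.simps C(2))
next
  case (2 \<sigma>)
  then have p: "1 / (2 * \<sigma>) > 0" by simp
  obtain C where C: "C > 0" "\<And>n::nat. (1 + real n) ^ k \<le> C * (r ^ n * fact n powr (1 / (2 * \<sigma>)))"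
    using fact_powr_dominates_power[OF r p, of k] by blast
  have "(1 + real (mlength \<alpha>)) ^ k \<le> C ^ CARD('d) * weight' r s \<alpha>" for \<alpha> :: "'d \<Rightarrow> nat"
  proof -
    have "(1 + real (mlength \<alpha>)) ^ k \<le> (\<Prod>i\<in>UNIV. 1 + real (\<alpha> i)) ^ k"
      using one_plus_sum_le_prod[of UNIV "\<lambda>i. real (\<alpha> i)"] by (intro power_mono) (auto simp: mlength_def add_nonneg_nonneg sum_nonneg)
    also have "\<dots> = (\<Prod>i\<in>UNIV. (1 + real (\<alpha> i)) ^ k)" by (simp add: prod_power_distrib)
    also have "\<dots> \<le> (\<Prod>i\<in>UNIV. C * (r ^ \<alpha> i * fact (\<alpha> i) powr (1 / (2 * \<sigma>))))"
      by (intro prod_mono conjI C) auto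
    also have "\<dots> = C ^ CARD('d) * weight' r s \<alpha>"
      unfolding 2 by (simp add: prod.distrib mlength_def mfact_def power_sum prod_powr_distrib)
    finally show ?thesis .
  qed
  moreover have "C ^ CARD('d) > 0" using C by simp
  ultimately show ?thesis by (rule that[rotated])
qed

text \<open>
  The exponent \<open>2 d\<close> lets the sum be compared with the product of \<open>d\<close> copies of \<open>\<Sum> 1 / (1 + n)\<^sup>2\<close>.
\<close>

lemma summable_on_inverse_mlength:
  "(\<lambda>\<alpha> :: 'd::finite \<Rightarrow> nat. 1 / (1 + real (mlength \<alpha>)) ^ (2 * CARD('d))) summable_on UNIV"
proof -
  have "summable (\<lambda>n. 1 / (1 + real n)\<^sup>2)"
    using inverse_power_summable[of 2, where 'a = real]
      summable_Suc_iff[of "\<lambda>n. inverse ((real n)\<^sup>2)"] by (simp add: inverse_eq_divide)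
  then have "Infinite_Set_Sum.abs_summable_on (\<lambda>n. 1 / (1 + real n)\<^sup>2) UNIV"
    by (simp add: abs_summable_on_nat_iff')
  then have "Infinite_Set_Sum.abs_summable_on (\<lambda>\<alpha> :: 'd \<Rightarrow> nat. \<Prod>i\<in>UNIV. 1 / (1 + real (\<alpha> i))\<^sup>2) (PiE UNIV (\<lambda>_. UNIV))"
    by (intro abs_summable_on_prod_PiE) auto
  then have "(\<lambda>\<alpha> :: 'd \<Rightarrow> nat. norm (\<Prod>i\<in>UNIV. 1 / (1 + real (\<alpha> i))\<^sup>2)) summable_on UNIV"
    by (simp add: abs_summable_equivalent[symmetric] PiE_UNIV_domain)
  then show ?thesis
  proof (rule summable_on_comparison_test)
    fix \<alpha> :: "'d \<Rightarrow> nat"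
    have "(\<Prod>i\<in>(UNIV :: 'd set). 1 / (1 + real (mlength \<alpha>))\<^sup>2) \<le> (\<Prod>i\<in>UNIV. 1 / (1 + real (\<alpha> i))\<^sup>2)"
      by (intro prod_mono conjI divide_left_mono power_mono) (auto intro: le_mlength)
    then show "1 / (1 + real (mlength \<alpha>)) ^ (2 * CARD('d)) \<le> norm (\<Prod>i\<in>UNIV. 1 / (1 + real (\<alpha> i))\<^sup>2)"
      by (simp add: power_mult power_divide prod_nonneg)
  qed simp
qed

lemma summable_on_reciprocal:
  assumes "\<And>\<alpha> :: 'd::finite \<Rightarrow> nat. (1 + real (mlength \<alpha>)) ^ (2 * CARD('d)) \<le> C * v \<alpha>"
    and "\<And>\<alpha>. v \<alpha> > 0" "C > 0"
  shows "(\<lambda>\<alpha>. 1 / v \<alpha>) summable_on UNIV"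
proof (rule summable_on_comparison_test)
  show "(\<lambda>\<alpha> :: 'd \<Rightarrow> nat. C * (1 / (1 + real (mlength \<alpha>)) ^ (2 * CARD('d)))) summable_on UNIV"
    by (intro summable_on_cmult_right summable_on_inverse_mlength)
  fix \<alpha> :: "'d \<Rightarrow> nat"
  show "1 / v \<alpha> \<le> C * (1 / (1 + real (mlength \<alpha>)) ^ (2 * CARD('d)))"
    using assms by (simp add: field_simps)
  show "0 \<le> 1 / v \<alpha>" using assms(2)[of \<alpha>] by simp
qed

text \<open>
  The dimension is passed as a type argument, since it does not occur in \<open>s\<close>, \<open>r\<close> and \<open>r'\<close>.
\<close>

definition summable_weights :: "'d::finite itself \<Rightarrow> pil_order \<Rightarrow> real \<Rightarrow> real \<Rightarrow> bool" where
  "summable_weights _ s r r' \<longleftrightarrow> (\<lambda>\<alpha> :: 'd \<Rightarrow> nat. weight r s \<alpha> * weight' r' s \<alpha>) summable_on UNIV"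

lemma summable_weights_Ord:
  assumes "\<sigma> > 0" "0 < r'" "r' < r"
  shows "summable_weights TYPE('d::finite) (Ord \<sigma>) r r'"
proof -
  have R: "Ord \<sigma> \<in> R_flat" using assms by (simp add: R_flat_def)
  have "r - r' > 0" using assms by simp
  then obtain C where C: "C > 0" "\<And>\<alpha> :: 'd \<Rightarrow> nat. (1 + real (mlength \<alpha>)) ^ (2 * CARD('d)) \<le> C * weight' (r - r') (Ord \<sigma>) \<alpha>"
    using weight'_dominates_power[OF R] by blast
  have "weight r (Ord \<sigma>) \<alpha> * weight' r' (Ord \<sigma>) \<alpha> = 1 / weight' (r - r') (Ord \<sigma>) \<alpha>" for \<alpha> :: "'d \<Rightarrow> nat"
  proof -
    have "exp (- r * x) * exp (r' * x) = 1 / exp ((r - r') * x)" for x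
      by (simp add: left_diff_distrib exp_diff exp_minus field_simps)
    then show ?thesis by (simp only: weight.simps weight'.simps)
  qed
  then show ?thesis
    unfolding summable_weights_def
    by (simp only: summable_on_reciprocal[OF C(2) weight'_pos[OF \<open>r - r' > 0\<close>] C(1)])
qed

lemma summable_weights_Flat:
  assumes "r > 0" "r' > 0" "r * r' = 1 / 2"
  shows "summable_weights TYPE('d::finite) (Flat \<sigma>) r r'"
proof -
  obtain C where C: "C > 0" "\<And>n::nat. (1 + real n) ^ (2 * CARD('d)) \<le> C * 2 ^ n"
    using two_power_dominates_power by blast
  have "weight r (Flat \<sigma>) \<alpha> * weight' r' (Flat \<sigma>) \<alpha> = 1 / 2 ^ mlength \<alpha>" for \<alpha> :: "'d \<Rightarrow> nat"
  proof -
    have "weight r (Flat \<sigma>) \<alpha> * weight' r' (Flat \<sigma>) \<alpha> = (r * r') ^ mlength \<alpha> *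
       (real (mfact \<alpha>) powr (- 1 / (2 * \<sigma>)) * real (mfact \<alpha>) powr (1 / (2 * \<sigma>)))"
      by (simp add: power_mult_distrib mult_ac)
    also have "real (mfact \<alpha>) powr (- 1 / (2 * \<sigma>)) * real (mfact \<alpha>) powr (1 / (2 * \<sigma>)) = 1"
      by (simp add: powr_add[symmetric] mfact_def)
    finally show ?thesis by (simp add: assms power_divide)
  qed
  then show ?thesis
    using summable_on_reciprocal[of C "\<lambda>\<alpha> :: 'd \<Rightarrow> nat. 2 ^ mlength \<alpha>"] C by (simp add: summable_weights_def)
qed

lemma summable_weights_ex_dual:
  assumes "s \<in> R_flat" "r > 0"
  shows "\<exists>r'>0. summable_weights TYPE('d::finite) s r r'"
  using assms(1)
proof (cases rule: R_flat_cases)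
  case (1 \<sigma>)
  then show ?thesis using summable_weights_Ord[of \<sigma> "r / 2" r] assms by (intro exI[of _ "r / 2"]) auto
next
  case (2 \<sigma>)
  then show ?thesis using summable_weights_Flat[of r "1 / (2 * r)" \<sigma>] assms by (intro exI[of _ "1 / (2 * r)"]) auto
qed

lemma summable_weights_ex:
  assumes "s \<in> R_flat" "r' > 0"
  shows "\<exists>r>0. summable_weights TYPE('d::finite) s r r'"
  using assms(1)
proof (cases rule: R_flat_cases)
  case (1 \<sigma>)
  then show ?thesis using summable_weights_Ord[of \<sigma> r' "2 * r'"] assms by (intro exI[of _ "2 * r'"]) auto
next
  case (2 \<sigma>)
  then show ?thesis using summable_weights_Flat[of "1 / (2 * r')" r' \<sigma>] assms by (intro exI[of _ "1 / (2 * r')"]) auto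
qed

section \<open>Submultiplicativity of the weights\<close>

lemma mlength_case_sum: "mlength (case_sum \<alpha> \<beta>) = mlength \<alpha> + mlength \<beta>"
  by (simp add: mlength_def UNIV_Plus_UNIV[symmetric] sum.Plus del: UNIV_Plus_UNIV)

lemma mfact_case_sum: "mfact (case_sum \<alpha> \<beta>) = mfact \<alpha> * mfact \<beta>"
  by (simp add: mfact_def prod_UNIV_sum)

lemma powr_le_mlength_case_sum:
  assumes "p \<ge> 0"
  shows "real (mlength \<alpha>) powr p \<le> real (mlength (case_sum \<alpha> \<beta>)) powr p"
    "real (mlength \<beta>) powr p \<le> real (mlength (case_sum \<alpha> \<beta>)) powr p"
  using assms by (auto simp: mlength_case_sum intro!: powr_mono2)

lemma weight_Flat_case_sum:
  "weight r (Flat \<sigma>) (case_sum \<alpha> \<beta>) = weight r (Flat \<sigma>) \<alpha> * weight r (Flat \<sigma>) \<beta>"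
  "weight' r (Flat \<sigma>) (case_sum \<alpha> \<beta>) = weight' r (Flat \<sigma>) \<alpha> * weight' r (Flat \<sigma>) \<beta>"
  by (simp_all add: mlength_case_sum mfact_case_sum power_add powr_mult)

lemma weight_Flat_mono:
  assumes "0 < r" "r \<le> r'"
  shows "weight r (Flat \<sigma>) \<alpha> \<le> weight r' (Flat \<sigma>) \<alpha>" "weight' r (Flat \<sigma>) \<alpha> \<le> weight' r' (Flat \<sigma>) \<alpha>"
  using assms by (auto intro!: mult_right_mono power_mono)

text \<open>
  Both \<open>\<bar>\<alpha>\<bar>\<close> and \<open>\<bar>\<beta>\<bar>\<close> are at most \<open>\<bar>(\<alpha>, \<beta>)\<bar>\<close>, so the two terms of the exponent are bounded separately
  by the same power and the parameters add up.
\<close>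

lemma weight_Ord_case_sum:
  assumes "\<sigma> > 0" "r1 > 0" "r2 > 0"
  shows "weight (r1 + r2) (Ord \<sigma>) (case_sum \<alpha> \<beta>) \<le> weight r1 (Ord \<sigma>) \<alpha> * weight r2 (Ord \<sigma>) \<beta>"
    "weight' r1 (Ord \<sigma>) \<alpha> * weight' r2 (Ord \<sigma>) \<beta> \<le> weight' (r1 + r2) (Ord \<sigma>) (case_sum \<alpha> \<beta>)"
proof -
  let ?p = "1 / (2 * \<sigma>)"
  have "r1 * real (mlength \<alpha>) powr ?p + r2 * real (mlength \<beta>) powr ?p
     \<le> r1 * real (mlength (case_sum \<alpha> \<beta>)) powr ?p + r2 * real (mlength (case_sum \<alpha> \<beta>)) powr ?p"
    using assms by (intro add_mono mult_left_mono powr_le_mlength_case_sum) auto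
  then show "weight (r1 + r2) (Ord \<sigma>) (case_sum \<alpha> \<beta>) \<le> weight r1 (Ord \<sigma>) \<alpha> * weight r2 (Ord \<sigma>) \<beta>"
    "weight' r1 (Ord \<sigma>) \<alpha> * weight' r2 (Ord \<sigma>) \<beta> \<le> weight' (r1 + r2) (Ord \<sigma>) (case_sum \<alpha> \<beta>)"
    by (simp_all add: mult_exp_exp algebra_simps)
qed

text \<open>
  This and the next lemma prescribe the parameters of the two factors, as required when test sequences
  have a bound for every parameter; the following two prescribe the parameter in dimension
  \<open>d\<^sub>1 + d\<^sub>2\<close>, as required when test sequences have a bound for some parameter.
\<close>

lemma weight_case_sum_le:
  assumes "s \<in> R_flat" "r1 > 0" "r2 > 0"
  shows "\<exists>r>0. \<forall>\<alpha> \<beta>. weight r s (case_sum \<alpha> \<beta>) \<le> weight r1 s \<alpha> * weight r2 s \<beta>"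
  using assms(1)
proof (cases rule: R_flat_cases)
  case (1 \<sigma>)
  then show ?thesis using weight_Ord_case_sum assms by (intro exI[of _ "r1 + r2"]) auto
next
  case (2 \<sigma>)
  then show ?thesis using assms unfolding 2 weight_Flat_case_sum
    by (intro exI[of _ "min r1 r2"] conjI allI mult_mono weight_Flat_mono)
       (auto intro!: less_imp_le weight_pos simp del: weight.simps)
qed

lemma weight'_case_sum_ge:
  assumes "s \<in> R_flat" "r1 > 0" "r2 > 0"
  shows "\<exists>r>0. \<forall>\<alpha> \<beta>. weight' r1 s \<alpha> * weight' r2 s \<beta> \<le> weight' r s (case_sum \<alpha> \<beta>)"
  using assms(1)
proof (cases rule: R_flat_cases)
  case (1 \<sigma>)
  then show ?thesis using weight_Ord_case_sum assms by (intro exI[of _ "r1 + r2"]) auto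
next
  case (2 \<sigma>)
  then show ?thesis using assms unfolding 2 weight_Flat_case_sum
    by (intro exI[of _ "max r1 r2"] conjI allI mult_mono weight_Flat_mono)
       (auto intro!: less_imp_le weight'_pos simp del: weight'.simps)
qed

lemma weight_case_sum_split:
  assumes "s \<in> R_flat" "r > 0"
  shows "\<exists>r1>0. \<forall>\<alpha> \<beta>. weight r s (case_sum \<alpha> \<beta>) \<le> weight r1 s \<alpha> * weight r1 s \<beta>"
  using assms(1)
proof (cases rule: R_flat_cases)
  case (1 \<sigma>)
  then show ?thesis using weight_Ord_case_sum(1)[of \<sigma> "r / 2" "r / 2"] assms by (intro exI[of _ "r / 2"]) (auto simp del: weight.simps weight'.simps)
next
  case (2 \<sigma>)
  then show ?thesis using assms
    by (intro exI[of _ r]) (simp add: weight_Flat_case_sum del: weight.simps weight'.simps)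
qed

lemma weight'_case_sum_split:
  assumes "s \<in> R_flat" "r > 0"
  shows "\<exists>r1>0. \<forall>\<alpha> \<beta>. weight' r1 s \<alpha> * weight' r1 s \<beta> \<le> weight' r s (case_sum \<alpha> \<beta>)"
  using assms(1)
proof (cases rule: R_flat_cases)
  case (1 \<sigma>)
  then show ?thesis using weight_Ord_case_sum(2)[of \<sigma> "r / 2" "r / 2"] assms by (intro exI[of _ "r / 2"]) (auto simp del: weight.simps weight'.simps)
next
  case (2 \<sigma>)
  then show ?thesis using assms
    by (intro exI[of _ r]) (simp add: weight_Flat_case_sum del: weight.simps weight'.simps)
qed

section \<open>Dominated sequences\<close>

lemma dominatedE:
  assumes "dominated c w" "\<And>\<alpha>. w \<alpha> > 0"
  obtains C where "C \<ge> 0" "\<And>\<alpha>. cmod (c \<alpha>) \<le> C * w \<alpha>"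
proof -
  obtain C where C: "\<And>\<alpha>. cmod (c \<alpha>) \<le> C * w \<alpha>" using assms(1) by (auto simp: dominated_def)
  have "0 \<le> C * w undefined" using C[of undefined] norm_ge_zero order.trans by blast
  then have "C \<ge> 0" using assms(2)[of undefined] by (simp add: zero_le_mult_iff)
  then show ?thesis using that C by blast
qed

lemma summable_on_dominated:
  assumes c: "dominated c w" "\<And>\<alpha>. w \<alpha> > 0" and f: "dominated f w'" "\<And>\<alpha>. w' \<alpha> > 0"
    and s: "(\<lambda>\<alpha>. w \<alpha> * w' \<alpha>) summable_on UNIV"
  shows "(\<lambda>\<alpha>. f \<alpha> * c \<alpha>) summable_on UNIV"
proof -
  obtain C where C: "C \<ge> 0" "\<And>\<alpha>. cmod (c \<alpha>) \<le> C * w \<alpha>" using dominatedE c by metis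
  obtain C' where C': "C' \<ge> 0" "\<And>\<alpha>. cmod (f \<alpha>) \<le> C' * w' \<alpha>" using dominatedE f by metis
  have "(\<lambda>\<alpha>. norm (f \<alpha> * c \<alpha>)) summable_on UNIV"
  proof (rule Infinite_Sum.abs_summable_on_comparison_test')
    show "(\<lambda>\<alpha>. (C * C') * (w \<alpha> * w' \<alpha>)) summable_on UNIV" by (intro summable_on_cmult_right s)
    fix \<alpha>
    have "norm (f \<alpha> * c \<alpha>) \<le> (C' * w' \<alpha>) * (C * w \<alpha>)"
      unfolding norm_mult using C' f(2)[of \<alpha>] by (intro mult_mono C C') auto
    then show "norm (f \<alpha> * c \<alpha>) \<le> (C * C') * (w \<alpha> * w' \<alpha>)" by (simp add: mult_ac)
  qed
  then show ?thesis by (simp add: summable_on_iff_abs_summable_on_complex)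
qed

lemma dominated_contraction:
  assumes k: "\<And>\<alpha> \<beta>. cmod (k \<alpha> \<beta>) \<le> C * (w1 \<alpha> * w2 \<beta>)" and "C \<ge> 0"
    and w: "\<And>\<alpha>. w1 \<alpha> > 0" "\<And>\<beta>. w2 \<beta> > 0" "\<And>\<beta>. w' \<beta> > 0"
    and f: "dominated f w'" and s: "(\<lambda>\<beta>. w2 \<beta> * w' \<beta>) summable_on UNIV"
  shows "dominated (\<lambda>\<alpha>. \<Sum>\<^sub>\<infinity>\<beta>. f \<beta> * k \<alpha> \<beta>) w1"
proof -
  obtain C' where C': "C' \<ge> 0" "\<And>\<alpha>. cmod (f \<alpha>) \<le> C' * w' \<alpha>" using dominatedE f w by metis
  have "cmod (\<Sum>\<^sub>\<infinity>\<beta>. f \<beta> * k \<alpha> \<beta>) \<le> (C * C' * (\<Sum>\<^sub>\<infinity>\<beta>. w2 \<beta> * w' \<beta>)) * w1 \<alpha>" for \<alpha>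
  proof -
    have le: "norm (f \<beta> * k \<alpha> \<beta>) \<le> (C * C' * w1 \<alpha>) * (w2 \<beta> * w' \<beta>)" for \<beta>
    proof -
      have "norm (f \<beta> * k \<alpha> \<beta>) \<le> (C' * w' \<beta>) * (C * (w1 \<alpha> * w2 \<beta>))"
        unfolding norm_mult using C' w(3)[of \<beta>] by (intro mult_mono k C') auto
      then show ?thesis by (simp add: mult_ac)
    qed
    have s': "(\<lambda>\<beta>. (C * C' * w1 \<alpha>) * (w2 \<beta> * w' \<beta>)) summable_on UNIV"
      by (intro summable_on_cmult_right s)
    have n: "(\<lambda>\<beta>. norm (f \<beta> * k \<alpha> \<beta>)) summable_on UNIV"
      using s' le by (rule Infinite_Sum.abs_summable_on_comparison_test')
    have "cmod (\<Sum>\<^sub>\<infinity>\<beta>. f \<beta> * k \<alpha> \<beta>) \<le> (\<Sum>\<^sub>\<infinity>\<beta>. norm (f \<beta> * k \<alpha> \<beta>))"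
      using n by (rule norm_infsum_bound)
    also have "\<dots> \<le> (\<Sum>\<^sub>\<infinity>\<beta>. (C * C' * w1 \<alpha>) * (w2 \<beta> * w' \<beta>))"
      using n s' le by (rule infsum_mono)
    also have "\<dots> = (C * C' * (\<Sum>\<^sub>\<infinity>\<beta>. w2 \<beta> * w' \<beta>)) * w1 \<alpha>"
      unfolding infsum_cmult_right' by (simp only: mult_ac)
    finally show ?thesis .
  qed
  then show ?thesis by (auto simp: dominated_def)
qed

lemma dominated_tensor:
  assumes f: "dominated f1 w1" "dominated f2 w2" and w: "\<And>\<alpha>. w1 \<alpha> > 0" "\<And>\<beta>. w2 \<beta> > 0"
    and le: "\<And>\<alpha> \<beta>. w1 \<alpha> * w2 \<beta> \<le> w (case_sum \<alpha> \<beta>)"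
  shows "dominated (\<lambda>\<gamma>. f1 (\<gamma> \<circ> Inl) * f2 (\<gamma> \<circ> Inr)) w"
proof -
  obtain C1 where C1: "C1 \<ge> 0" "\<And>\<alpha>. cmod (f1 \<alpha>) \<le> C1 * w1 \<alpha>" using dominatedE f w by metis
  obtain C2 where C2: "C2 \<ge> 0" "\<And>\<alpha>. cmod (f2 \<alpha>) \<le> C2 * w2 \<alpha>" using dominatedE f w by metis
  have "cmod (f1 (\<gamma> \<circ> Inl) * f2 (\<gamma> \<circ> Inr)) \<le> (C1 * C2) * w \<gamma>" for \<gamma>
  proof -
    have "cmod (f1 (\<gamma> \<circ> Inl) * f2 (\<gamma> \<circ> Inr)) \<le> (C1 * w1 (\<gamma> \<circ> Inl)) * (C2 * w2 (\<gamma> \<circ> Inr))"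
      unfolding norm_mult using C1 w(1)[of "\<gamma> \<circ> Inl"] by (intro mult_mono C1 C2) auto
    also have "\<dots> = (C1 * C2) * (w1 (\<gamma> \<circ> Inl) * w2 (\<gamma> \<circ> Inr))" by (simp add: mult_ac)
    also have "\<dots> \<le> (C1 * C2) * w (case_sum (\<gamma> \<circ> Inl) (\<gamma> \<circ> Inr))"
      using C1 C2 by (intro mult_left_mono le) auto
    finally show ?thesis by (simp only: case_sum_eta)
  qed
  then show ?thesis by (auto simp: dominated_def)
qed

lemma dominated_unit: "(\<And>\<alpha>. w \<alpha> > 0) \<Longrightarrow> dominated (\<lambda>\<alpha>. if \<alpha> = \<beta> then 1 else 0) w"
  unfolding dominated_def by (rule exI[of _ "1 / w \<beta>"]) (simp add: less_imp_le less_imp_neq[symmetric])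

lemma dominated_poly_growth:
  fixes f :: "('d::finite \<Rightarrow> nat) \<Rightarrow> complex"
  assumes "poly_growth f" "s \<in> R_flat" "r > 0"
  shows "dominated f (weight' r s)"
proof -
  obtain C k where C: "\<And>\<alpha>. cmod (f \<alpha>) \<le> C * (1 + real (mlength \<alpha>)) ^ k"
    using assms(1) by (auto simp: poly_growth_def)
  obtain C' where C': "C' > 0" "\<And>\<alpha> :: 'd \<Rightarrow> nat. (1 + real (mlength \<alpha>)) ^ k \<le> C' * weight' r s \<alpha>"
    using weight'_dominates_power assms(2,3) by blast
  have "cmod (f \<alpha>) \<le> \<bar>C\<bar> * C' * weight' r s \<alpha>" for \<alpha>
  proof -
    have "cmod (f \<alpha>) \<le> \<bar>C\<bar> * (1 + real (mlength \<alpha>)) ^ k"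
      by (rule order.trans[OF C mult_right_mono]) auto
    also have "\<dots> \<le> \<bar>C\<bar> * (C' * weight' r s \<alpha>)" by (intro mult_left_mono C') auto
    finally show ?thesis by (simp add: mult_ac)
  qed
  then show ?thesis by (auto simp: dominated_def)
qed

section \<open>The three pairs of sequence spaces\<close>

definition finite_seqs :: "(('d::finite \<Rightarrow> nat) \<Rightarrow> complex) set" where
  "finite_seqs = {c. finite {\<alpha>. c \<alpha> \<noteq> 0}}"

text \<open>
  As in the theory of ultradistributions, spaces with a bound for some parameter are named after
  Roumieu and those with a bound for every parameter after Beurling.
\<close>

definition roumieu_seqs :: "pil_order \<Rightarrow> (('d::finite \<Rightarrow> nat) \<Rightarrow> complex) set" where
  "roumieu_seqs s = {c. \<exists>r>0. dominated c (weight r s)}"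

definition beurling_seqs :: "pil_order \<Rightarrow> (('d::finite \<Rightarrow> nat) \<Rightarrow> complex) set" where
  "beurling_seqs s = {c. \<forall>r>0. dominated c (weight r s)}"

lemma sequence_dual_pair_finite:
  "sequence_dual_pair (finite_seqs :: ((('d::finite \<Rightarrow> nat) \<Rightarrow> complex) set)) UNIV"
proof
  show "(\<lambda>\<alpha>. if \<alpha> = \<beta> then 1 else 0) \<in> finite_seqs" for \<beta> :: "'d \<Rightarrow> nat"
    by (simp add: finite_seqs_def)
  show "(\<lambda>\<alpha>. f \<alpha> * c \<alpha>) summable_on UNIV" if "c \<in> finite_seqs" for c f :: "('d \<Rightarrow> nat) \<Rightarrow> complex"
    using that by (intro finite_nonzero_values_imp_summable_on) (auto simp: finite_seqs_def elim: finite_subset[rotated])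
qed simp

lemma finite_seqs_contraction:
  assumes "finite {p. k (fst p) (snd p) \<noteq> 0}"
  shows "(\<lambda>\<alpha>. \<Sum>\<^sub>\<infinity>\<beta>. f \<beta> * k \<alpha> \<beta>) \<in> finite_seqs"
proof -
  have "{\<alpha>. (\<Sum>\<^sub>\<infinity>\<beta>. f \<beta> * k \<alpha> \<beta>) \<noteq> 0} \<subseteq> fst ` {p. k (fst p) (snd p) \<noteq> 0}"
  proof
    fix \<alpha> assume "\<alpha> \<in> {\<alpha>. (\<Sum>\<^sub>\<infinity>\<beta>. f \<beta> * k \<alpha> \<beta>) \<noteq> 0}"
    then obtain \<beta> where "f \<beta> * k \<alpha> \<beta> \<noteq> 0"
      using infsum_0[of UNIV "\<lambda>\<beta>. f \<beta> * k \<alpha> \<beta>"] by auto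
    then show "\<alpha> \<in> fst ` {p. k (fst p) (snd p) \<noteq> 0}"
      by (intro image_eqI[of _ _ "(\<alpha>, \<beta>)"]) auto
  qed
  then show ?thesis unfolding finite_seqs_def using assms by (auto intro: finite_surj)
qed

lemma tensor_dual_pairs_finite:
  "tensor_dual_pairs (finite_seqs :: (('m::finite \<Rightarrow> nat) \<Rightarrow> complex) set) UNIV
     (finite_seqs :: (('n::finite \<Rightarrow> nat) \<Rightarrow> complex) set) UNIV finite_seqs UNIV"
proof (intro tensor_dual_pairs.intro sequence_dual_pair_finite tensor_dual_pairs_axioms.intro)
  fix c :: "('m + 'n \<Rightarrow> nat) \<Rightarrow> complex"
  assume "c \<in> finite_seqs"
  then have fin: "finite {\<gamma>. c \<gamma> \<noteq> 0}" by (simp add: finite_seqs_def)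
  have "finite ((\<lambda>\<gamma>. (\<gamma> \<circ> Inl, \<gamma> \<circ> Inr)) ` {\<gamma>. c \<gamma> \<noteq> 0})" using fin by simp
  then show "(\<lambda>\<alpha>. \<Sum>\<^sub>\<infinity>\<beta>. f \<beta> * c (case_sum \<alpha> \<beta>)) \<in> finite_seqs" for f :: "('n \<Rightarrow> nat) \<Rightarrow> complex"
    by (intro finite_seqs_contraction) (erule finite_subset[rotated], force simp: case_sum_comp image_iff)
  have "finite ((\<lambda>\<gamma>. (\<gamma> \<circ> Inr, \<gamma> \<circ> Inl)) ` {\<gamma>. c \<gamma> \<noteq> 0})" using fin by simp
  then show "(\<lambda>\<beta>. \<Sum>\<^sub>\<infinity>\<alpha>. f \<alpha> * c (case_sum \<alpha> \<beta>)) \<in> finite_seqs" for f :: "('m \<Rightarrow> nat) \<Rightarrow> complex"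
    by (intro finite_seqs_contraction) (erule finite_subset[rotated], force simp: case_sum_comp image_iff)
qed simp

text \<open>
  The test sequence fixes its parameter first; the dual sequence, bounded for every parameter, is then
  used with one that makes the product of the weights summable.
\<close>

lemma sequence_dual_pair_roumieu:
  assumes s: "s \<in> R_flat"
  shows "sequence_dual_pair (roumieu_seqs s :: (('d::finite \<Rightarrow> nat) \<Rightarrow> complex) set)
     {f. \<forall>r>0. dominated f (weight' r s)}"
proof
  show "(\<lambda>\<alpha>. if \<alpha> = \<beta> then 1 else 0) \<in> roumieu_seqs s" for \<beta> :: "'d \<Rightarrow> nat"
    unfolding roumieu_seqs_def by (auto intro!: exI[of _ 1] dominated_unit weight_pos simp del: weight.simps)
  show "f \<in> {f. \<forall>r>0. dominated f (weight' r s)}" if "poly_growth f" for f :: "('d \<Rightarrow> nat) \<Rightarrow> complex"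
    using dominated_poly_growth[OF that s] by blast
  fix c f :: "('d \<Rightarrow> nat) \<Rightarrow> complex"
  assume c: "c \<in> roumieu_seqs s" and f: "f \<in> {f. \<forall>r>0. dominated f (weight' r s)}"
  obtain r where r: "r > 0" "dominated c (weight r s)" using c by (auto simp: roumieu_seqs_def)
  obtain r' where r': "r' > 0" "summable_weights TYPE('d) s r r'" using summable_weights_ex_dual[OF s r(1)] by blast
  show "(\<lambda>\<alpha>. f \<alpha> * c \<alpha>) summable_on UNIV"
  proof (rule summable_on_dominated[OF r(2) weight_pos[OF r(1)]])
    show "dominated f (weight' r' s)" using f r'(1) by blast
  qed (use r' weight'_pos in \<open>auto simp: summable_weights_def\<close>)
qed

text \<open>
  Here the roles are exchanged: the dual sequence fixes its parameter, and the test sequence adapts.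
\<close>

lemma sequence_dual_pair_beurling:
  assumes s: "s \<in> R_flat"
  shows "sequence_dual_pair (beurling_seqs s :: (('d::finite \<Rightarrow> nat) \<Rightarrow> complex) set) (pil_small_dual s)"
proof
  show "(\<lambda>\<alpha>. if \<alpha> = \<beta> then 1 else 0) \<in> beurling_seqs s" for \<beta> :: "'d \<Rightarrow> nat"
    unfolding beurling_seqs_def by (auto intro!: dominated_unit weight_pos simp del: weight.simps)
  show "f \<in> pil_small_dual s" if "poly_growth f" for f :: "('d \<Rightarrow> nat) \<Rightarrow> complex"
    using dominated_poly_growth[OF that s, of 1] unfolding pil_small_dual_def by (intro CollectI exI[of _ 1]) simp
  fix c f :: "('d \<Rightarrow> nat) \<Rightarrow> complex"
  assume c: "c \<in> beurling_seqs s" and f: "f \<in> pil_small_dual s"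
  obtain r' where r': "r' > 0" "dominated f (weight' r' s)" using f by (auto simp: pil_small_dual_def)
  obtain r where r: "r > 0" "summable_weights TYPE('d) s r r'" using summable_weights_ex[OF s r'(1)] by blast
  show "(\<lambda>\<alpha>. f \<alpha> * c \<alpha>) summable_on UNIV"
  proof (rule summable_on_dominated[OF _ weight_pos[OF r(1)] r'(2) weight'_pos[OF r'(1)]])
    show "dominated c (weight r s)" using c r(1) by (simp add: beurling_seqs_def)
  qed (use r in \<open>auto simp: summable_weights_def\<close>)
qed

lemma tensor_dual_pairs_roumieu:
  assumes s: "s \<in> R_flat"
  shows "tensor_dual_pairs
     (roumieu_seqs s :: (('m::finite \<Rightarrow> nat) \<Rightarrow> complex) set) {f. \<forall>r>0. dominated f (weight' r s)}
     (roumieu_seqs s :: (('n::finite \<Rightarrow> nat) \<Rightarrow> complex) set) {f. \<forall>r>0. dominated f (weight' r s)}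
     (roumieu_seqs s) {f. \<forall>r>0. dominated f (weight' r s)}"
proof (intro tensor_dual_pairs.intro sequence_dual_pair_roumieu s tensor_dual_pairs_axioms.intro)
  fix c :: "('m + 'n \<Rightarrow> nat) \<Rightarrow> complex"
  assume "c \<in> roumieu_seqs s"
  then obtain r where r: "r > 0" "dominated c (weight r s)" by (auto simp: roumieu_seqs_def)
  obtain r1 where r1: "r1 > 0"
    "\<And>\<alpha> \<beta>. weight r s (case_sum \<alpha> \<beta> :: 'm + 'n \<Rightarrow> nat) \<le> weight r1 s \<alpha> * weight r1 s \<beta>"
    using weight_case_sum_split[OF s r(1)] by blast
  obtain C where C: "C \<ge> 0" "\<And>\<gamma>. cmod (c \<gamma>) \<le> C * weight r s \<gamma>"
    using dominatedE[OF r(2) weight_pos[OF r(1)]] by blast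
  have le: "cmod (c (case_sum \<alpha> \<beta>)) \<le> C * (weight r1 s \<alpha> * weight r1 s \<beta>)" for \<alpha> \<beta>
    by (rule order.trans[OF C(2) mult_left_mono[OF r1(2) C(1)]])
  show "(\<lambda>\<alpha>. \<Sum>\<^sub>\<infinity>\<beta>. f \<beta> * c (case_sum \<alpha> \<beta>)) \<in> roumieu_seqs s"
    if f: "f \<in> {f. \<forall>r>0. dominated f (weight' r s)}" for f
  proof -
    obtain r' where r': "r' > 0" "summable_weights TYPE('n) s r1 r'" using summable_weights_ex_dual[OF s r1(1)] by blast
    have f': "dominated f (weight' r' s)" using f r' by blast
    have "dominated (\<lambda>\<alpha>. \<Sum>\<^sub>\<infinity>\<beta>. f \<beta> * c (case_sum \<alpha> \<beta>)) (weight r1 s)"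
    proof (rule dominated_contraction[where C = C and ?w2.0 = "weight r1 s" and w' = "weight' r' s"])
      show "(\<lambda>\<beta> :: 'n \<Rightarrow> nat. weight r1 s \<beta> * weight' r' s \<beta>) summable_on UNIV"
        using r'(2) by (simp only: summable_weights_def)
    qed (rule le C(1) weight_pos[OF r1(1)] weight'_pos[OF r'(1)] f')+
    then show ?thesis using r1(1) by (auto simp: roumieu_seqs_def)
  qed
  show "(\<lambda>\<beta>. \<Sum>\<^sub>\<infinity>\<alpha>. f \<alpha> * c (case_sum \<alpha> \<beta>)) \<in> roumieu_seqs s"
    if f: "f \<in> {f. \<forall>r>0. dominated f (weight' r s)}" for f
  proof -
    obtain r' where r': "r' > 0" "summable_weights TYPE('m) s r1 r'" using summable_weights_ex_dual[OF s r1(1)] by blast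
    have f': "dominated f (weight' r' s)" using f r' by blast
    have le': "cmod (c (case_sum \<alpha> \<beta>)) \<le> C * (weight r1 s \<beta> * weight r1 s \<alpha>)" for \<alpha> \<beta>
      using le[of \<alpha> \<beta>] by (simp only: mult.commute)
    have "dominated (\<lambda>\<beta>. \<Sum>\<^sub>\<infinity>\<alpha>. f \<alpha> * c (case_sum \<alpha> \<beta>)) (weight r1 s)"
    proof (rule dominated_contraction[where C = C and ?w2.0 = "weight r1 s" and w' = "weight' r' s"])
      show "(\<lambda>\<beta> :: 'm \<Rightarrow> nat. weight r1 s \<beta> * weight' r' s \<beta>) summable_on UNIV"
        using r'(2) by (simp only: summable_weights_def)
    qed (rule le' C(1) weight_pos[OF r1(1)] weight'_pos[OF r'(1)] f')+
    then show ?thesis using r1(1) by (auto simp: roumieu_seqs_def)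
  qed
next
  fix f1 :: "('m \<Rightarrow> nat) \<Rightarrow> complex" and f2 :: "('n \<Rightarrow> nat) \<Rightarrow> complex"
  assume f: "f1 \<in> {f. \<forall>r>0. dominated f (weight' r s)}" "f2 \<in> {f. \<forall>r>0. dominated f (weight' r s)}"
  have "dominated (\<lambda>\<gamma>. f1 (\<gamma> \<circ> Inl) * f2 (\<gamma> \<circ> Inr)) (weight' r s)" if r: "r > 0" for r
  proof -
    obtain r1 where r1: "r1 > 0"
      "\<And>\<alpha> \<beta>. weight' r1 s \<alpha> * weight' r1 s \<beta> \<le> weight' r s (case_sum \<alpha> \<beta> :: 'm + 'n \<Rightarrow> nat)"
      using weight'_case_sum_split[OF s r] by blast
    have f': "dominated f1 (weight' r1 s)" "dominated f2 (weight' r1 s)" using f r1(1) by blast+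
    show ?thesis
      by (rule dominated_tensor[OF f' weight'_pos[OF r1(1)] weight'_pos[OF r1(1)] r1(2)])
  qed
  then show "(\<lambda>\<gamma>. f1 (\<gamma> \<circ> Inl) * f2 (\<gamma> \<circ> Inr)) \<in> {f. \<forall>r>0. dominated f (weight' r s)}" by blast
qed

lemma tensor_dual_pairs_beurling:
  assumes s: "s \<in> R_flat"
  shows "tensor_dual_pairs
     (beurling_seqs s :: (('m::finite \<Rightarrow> nat) \<Rightarrow> complex) set) (pil_small_dual s)
     (beurling_seqs s :: (('n::finite \<Rightarrow> nat) \<Rightarrow> complex) set) (pil_small_dual s)
     (beurling_seqs s) (pil_small_dual s)"
proof (intro tensor_dual_pairs.intro sequence_dual_pair_beurling s tensor_dual_pairs_axioms.intro)
  fix c :: "('m + 'n \<Rightarrow> nat) \<Rightarrow> complex"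
  assume c: "c \<in> beurling_seqs s"
  have le: "\<exists>C\<ge>0. \<forall>\<alpha> \<beta>. cmod (c (case_sum \<alpha> \<beta>)) \<le> C * (weight r1 s \<alpha> * weight r2 s \<beta>)"
    if r12: "r1 > 0" "r2 > 0" for r1 r2
  proof -
    obtain r where r: "r > 0"
      "\<And>\<alpha> \<beta>. weight r s (case_sum \<alpha> \<beta> :: 'm + 'n \<Rightarrow> nat) \<le> weight r1 s \<alpha> * weight r2 s \<beta>"
      using weight_case_sum_le[OF s r12] by blast
    have c': "dominated c (weight r s)" using c r(1) by (simp add: beurling_seqs_def)
    obtain C where C: "C \<ge> 0" "\<And>\<gamma>. cmod (c \<gamma>) \<le> C * weight r s \<gamma>"
      using dominatedE[OF c' weight_pos[OF r(1)]] by blast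
    then show ?thesis using order.trans[OF C(2) mult_left_mono[OF r(2) C(1)]] by blast
  qed
  show "(\<lambda>\<alpha>. \<Sum>\<^sub>\<infinity>\<beta>. f \<beta> * c (case_sum \<alpha> \<beta>)) \<in> beurling_seqs s" if f: "f \<in> pil_small_dual s" for f
  proof -
    obtain r' where r': "r' > 0" "dominated f (weight' r' s)" using f by (auto simp: pil_small_dual_def)
    obtain r2 where r2: "r2 > 0" "summable_weights TYPE('n) s r2 r'" using summable_weights_ex[OF s r'(1)] by blast
    have "dominated (\<lambda>\<alpha>. \<Sum>\<^sub>\<infinity>\<beta>. f \<beta> * c (case_sum \<alpha> \<beta>)) (weight r1 s)" if r1: "r1 > 0" for r1
    proof -
      obtain C where C: "C \<ge> 0" "\<And>\<alpha> \<beta>. cmod (c (case_sum \<alpha> \<beta>)) \<le> C * (weight r1 s \<alpha> * weight r2 s \<beta>)"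
        using le[OF r1 r2(1)] by blast
      show ?thesis
      proof (rule dominated_contraction[where C = C and ?w2.0 = "weight r2 s" and w' = "weight' r' s"])
        show "(\<lambda>\<beta> :: 'n \<Rightarrow> nat. weight r2 s \<beta> * weight' r' s \<beta>) summable_on UNIV"
          using r2(2) by (simp only: summable_weights_def)
      qed (rule C weight_pos[OF r1] weight_pos[OF r2(1)] weight'_pos[OF r'(1)] r'(2))+
    qed
    then show ?thesis by (simp add: beurling_seqs_def)
  qed
  show "(\<lambda>\<beta>. \<Sum>\<^sub>\<infinity>\<alpha>. f \<alpha> * c (case_sum \<alpha> \<beta>)) \<in> beurling_seqs s" if f: "f \<in> pil_small_dual s" for f
  proof -
    obtain r' where r': "r' > 0" "dominated f (weight' r' s)" using f by (auto simp: pil_small_dual_def)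
    obtain r1 where r1: "r1 > 0" "summable_weights TYPE('m) s r1 r'" using summable_weights_ex[OF s r'(1)] by blast
    have "dominated (\<lambda>\<beta>. \<Sum>\<^sub>\<infinity>\<alpha>. f \<alpha> * c (case_sum \<alpha> \<beta>)) (weight r2 s)" if r2: "r2 > 0" for r2
    proof -
      obtain C where C: "C \<ge> 0" "\<And>\<alpha> \<beta>. cmod (c (case_sum \<alpha> \<beta>)) \<le> C * (weight r1 s \<alpha> * weight r2 s \<beta>)"
        using le[OF r1(1) r2] by blast
      have C': "cmod (c (case_sum \<alpha> \<beta>)) \<le> C * (weight r2 s \<beta> * weight r1 s \<alpha>)" for \<alpha> \<beta>
        using C(2)[of \<alpha> \<beta>] by (simp only: mult.commute)
      show ?thesis
      proof (rule dominated_contraction[where C = C and ?w2.0 = "weight r1 s" and w' = "weight' r' s"])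
        show "(\<lambda>\<beta> :: 'm \<Rightarrow> nat. weight r1 s \<beta> * weight' r' s \<beta>) summable_on UNIV"
          using r1(2) by (simp only: summable_weights_def)
      qed (rule C' C(1) weight_pos[OF r2] weight_pos[OF r1(1)] weight'_pos[OF r'(1)] r'(2))+
    qed
    then show ?thesis by (simp add: beurling_seqs_def)
  qed
next
  fix f1 :: "('m \<Rightarrow> nat) \<Rightarrow> complex" and f2 :: "('n \<Rightarrow> nat) \<Rightarrow> complex"
  assume f: "f1 \<in> pil_small_dual s" "f2 \<in> pil_small_dual s"
  obtain r1 where r1: "r1 > 0" "dominated f1 (weight' r1 s)" using f by (auto simp: pil_small_dual_def)
  obtain r2 where r2: "r2 > 0" "dominated f2 (weight' r2 s)" using f by (auto simp: pil_small_dual_def)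
  obtain r where r: "r > 0"
    "\<And>\<alpha> \<beta>. weight' r1 s \<alpha> * weight' r2 s \<beta> \<le> weight' r s (case_sum \<alpha> \<beta> :: 'm + 'n \<Rightarrow> nat)"
    using weight'_case_sum_ge[OF s r1(1) r2(1)] by blast
  have "dominated (\<lambda>\<gamma>. f1 (\<gamma> \<circ> Inl) * f2 (\<gamma> \<circ> Inr)) (weight' r s)"
    by (rule dominated_tensor[OF r1(2) r2(2) weight'_pos[OF r1(1)] weight'_pos[OF r2(1)] r(2)])
  then show "(\<lambda>\<gamma>. f1 (\<gamma> \<circ> Inl) * f2 (\<gamma> \<circ> Inr)) \<in> pil_small_dual s"
    using r(1) by (auto simp: pil_small_dual_def)
qed

section \<open>Tensor products of functionals on the Pilipovic spaces\<close>

lemma R_flat_not_Ord_0: "s \<in> R_flat \<Longrightarrow> s \<noteq> Ord 0"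
  by (auto simp: R_flat_def)

lemma pil_0: "pil (Ord 0) = hermite_space finite_seqs"
proof -
  have "pil0 = (hermite_space finite_seqs :: (real ^ 'd::finite \<Rightarrow> complex) set)"
  proof (intro equalityI subsetI)
    fix f :: "real ^ 'd \<Rightarrow> complex"
    assume "f \<in> pil0"
    then obtain A c where A: "finite A" and f: "f = (\<lambda>x. \<Sum>\<alpha>\<in>A. c \<alpha> * complex_of_real (hermite_fun \<alpha> x))"
      by (auto simp: pil0_def)
    define c' where "c' \<alpha> = (if \<alpha> \<in> A then c \<alpha> else 0)" for \<alpha>
    have "{\<alpha>. c' \<alpha> \<noteq> 0} \<subseteq> A" by (auto simp: c'_def)
    then have "c' \<in> finite_seqs" using A by (auto simp: finite_seqs_def intro: finite_subset)
    moreover have "((\<lambda>\<alpha>. c' \<alpha> * complex_of_real (hermite_fun \<alpha> x)) has_sum f x) UNIV" for x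
      by (rule has_sum_finite_neutralI[OF A]) (auto simp: c'_def f)
    ultimately show "f \<in> hermite_space finite_seqs" by (auto simp: hermite_space_def)
  next
    fix f :: "real ^ 'd \<Rightarrow> complex"
    assume "f \<in> hermite_space finite_seqs"
    then obtain c where c: "finite {\<alpha>. c \<alpha> \<noteq> 0}"
      and f: "\<And>x. ((\<lambda>\<alpha>. c \<alpha> * complex_of_real (hermite_fun \<alpha> x)) has_sum f x) UNIV"
      by (auto simp: hermite_space_def finite_seqs_def)
    have "f x = (\<Sum>\<alpha>\<in>{\<alpha>. c \<alpha> \<noteq> 0}. c \<alpha> * complex_of_real (hermite_fun \<alpha> x))" for x
    proof (rule has_sum_unique[OF f])
      show "((\<lambda>\<alpha>. c \<alpha> * complex_of_real (hermite_fun \<alpha> x)) has_sum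
          (\<Sum>\<alpha>\<in>{\<alpha>. c \<alpha> \<noteq> 0}. c \<alpha> * complex_of_real (hermite_fun \<alpha> x))) UNIV"
        by (rule has_sum_finite_neutralI[OF c]) auto
    qed
    then show "f \<in> pil0" unfolding pil0_def using c by blast
  qed
  then show ?thesis by (simp add: pil_def)
qed

lemma pil_eq_hermite_space: "s \<in> R_flat \<Longrightarrow> pil s = hermite_space (roumieu_seqs s)"
  unfolding sequence_dual_pair.hermite_space_eq[OF sequence_dual_pair_roumieu]
  by (simp add: pil_def roumieu_seqs_def R_flat_not_Ord_0)

lemma pil_small_eq_hermite_space: "s \<in> R_flat \<Longrightarrow> pil_small s = hermite_space (beurling_seqs s)"
  unfolding sequence_dual_pair.hermite_space_eq[OF sequence_dual_pair_beurling]
  by (simp add: pil_small_def beurling_seqs_def)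

text \<open>
  Each of the three cases is \<open>tensor_product_of_functionals\<close> for the corresponding sequence spaces.
\<close>

theorem theorem1p3:
  fixes s :: pil_order
    and f1 :: "('m::finite \<Rightarrow> nat) \<Rightarrow> complex"
    and f2 :: "('n::finite \<Rightarrow> nat) \<Rightarrow> complex"
    and \<phi> :: "real ^ ('m + 'n) \<Rightarrow> complex"
    and \<psi>1 :: "real ^ 'm \<Rightarrow> complex"
    and \<psi>2 :: "real ^ 'n \<Rightarrow> complex"
  assumes psi1: "\<And>x1. \<psi>1 x1 = pairing f2 (\<lambda>x2. \<phi> (join x1 x2))"
    and psi2: "\<And>x2. \<psi>2 x2 = pairing f1 (\<lambda>x1. \<phi> (join x1 x2))"
  shows
    "(s \<in> R_flat_bar \<and> f1 \<in> pil_dual s \<and> f2 \<in> pil_dual s \<and> \<phi> \<in> pil s \<longrightarrow>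
        \<psi>1 \<in> pil s \<and> \<psi>2 \<in> pil s \<and>
        (\<exists>!f. f \<in> pil_dual s \<and>
           (\<forall>\<phi>1 \<in> pil s. \<forall>\<phi>2 \<in> pil s.
              pairing f (tensor \<phi>1 \<phi>2) = pairing f1 \<phi>1 * pairing f2 \<phi>2) \<and>
           pairing f \<phi> = pairing f1 \<psi>1 \<and> pairing f1 \<psi>1 = pairing f2 \<psi>2)) \<and>
     (s \<in> R_flat \<and> f1 \<in> pil_small_dual s \<and> f2 \<in> pil_small_dual s \<and> \<phi> \<in> pil_small s \<longrightarrow>
        \<psi>1 \<in> pil_small s \<and> \<psi>2 \<in> pil_small s \<and>
        (\<exists>!f. f \<in> pil_small_dual s \<and>
           (\<forall>\<phi>1 \<in> pil_small s. \<forall>\<phi>2 \<in> pil_small s.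
              pairing f (tensor \<phi>1 \<phi>2) = pairing f1 \<phi>1 * pairing f2 \<phi>2) \<and>
           pairing f \<phi> = pairing f1 \<psi>1 \<and> pairing f1 \<psi>1 = pairing f2 \<psi>2))"
proof (intro conjI[of "_ \<longrightarrow> _" "_ \<longrightarrow> _"] impI)
  assume A: "s \<in> R_flat_bar \<and> f1 \<in> pil_dual s \<and> f2 \<in> pil_dual s \<and> \<phi> \<in> pil s"
  then consider "s = Ord 0" | "s \<in> R_flat" by (auto simp: R_flat_bar_def)
  then show "\<psi>1 \<in> pil s \<and> \<psi>2 \<in> pil s \<and>
        (\<exists>!f. f \<in> pil_dual s \<and>
           (\<forall>\<phi>1 \<in> pil s. \<forall>\<phi>2 \<in> pil s.
              pairing f (tensor \<phi>1 \<phi>2) = pairing f1 \<phi>1 * pairing f2 \<phi>2) \<and>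
           pairing f \<phi> = pairing f1 \<psi>1 \<and> pairing f1 \<psi>1 = pairing f2 \<psi>2)"
  proof cases
    case 1
    have D: "pil_dual (Ord 0) = UNIV" by (simp add: pil_dual_def)
    show ?thesis
      using A unfolding 1 pil_0 D
      by (intro tensor_dual_pairs.tensor_product_of_functionals[OF tensor_dual_pairs_finite _ _ _ psi1 psi2]) auto
  next
    case 2
    have D: "pil_dual s = {f. \<forall>r>0. dominated f (weight' r s)}"
      using R_flat_not_Ord_0[OF 2] by (simp add: pil_dual_def)
    show ?thesis
      using A unfolding pil_eq_hermite_space[OF 2] D
      by (intro tensor_dual_pairs.tensor_product_of_functionals[OF tensor_dual_pairs_roumieu[OF 2] _ _ _ psi1 psi2]) auto
  qed
next
  assume A: "s \<in> R_flat \<and> f1 \<in> pil_small_dual s \<and> f2 \<in> pil_small_dual s \<and> \<phi> \<in> pil_small s"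
  then have s: "s \<in> R_flat" by blast
  show "\<psi>1 \<in> pil_small s \<and> \<psi>2 \<in> pil_small s \<and>
        (\<exists>!f. f \<in> pil_small_dual s \<and>
           (\<forall>\<phi>1 \<in> pil_small s. \<forall>\<phi>2 \<in> pil_small s.
              pairing f (tensor \<phi>1 \<phi>2) = pairing f1 \<phi>1 * pairing f2 \<phi>2) \<and>
           pairing f \<phi> = pairing f1 \<psi>1 \<and> pairing f1 \<psi>1 = pairing f2 \<psi>2)"
    using A unfolding pil_small_eq_hermite_space[OF s]
    by (intro tensor_dual_pairs.tensor_product_of_functionals[OF tensor_dual_pairs_beurling[OF s] _ _ _ psi1 psi2]) auto
qed

end
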